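(* Let $h_1\colon C_1\to C_1$ and $h_2\colon C_2\to C_2$ be minimal homeomorphisms of Cantor sets (with fixed compatible metrics). Then $h_1$ and $h_2$ are germinally equivalent if and only if the suspensions of $h_1$ and $h_2$ are flow equivalent.
   Context: The suspension of a homeomorphism $h\colon Z\to Z$ is the quotient of $Z\times[0,1]$ by $(z,1)\sim(h(z),0)$, with the flow induced by translation in the second coordinate. A flow equivalence between flow spaces is a homeomorphism mapping orbits onto orbits and preserving the orientation of orbits induced by the flows. For a homeomorphism $h$ of $C$ and a subset $N\subset C$, the return homeomorphism of $h$ to $N$ is the first-return map $x\mapsto h^{r(x)}(x)$, $r(x)=\min\{k\ge1:h^k(x)\in N\}$. $h_1$ and $h_2$ are germinally equivalent if for each $i\in\{1,2\}$ and each clopen $K\subset C_i$ there is $\delta_K>0$ such that for every neighbourhood $N'\subset C_{i+1}$ (index taken mod 2) with diameter less than $\delta_K$ there is a neighbourhood $N\subset K$ such that the return homeomorphism of $h_i$ to $N$ is topologically conjugate to the return homeomorphism of $h_{i+1}$ to $N'$. *)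

theory Defs
  imports "HOL-Analysis.Analysis"
begin

definition cantor_set :: "'a::metric_space set \<Rightarrow> bool" where
  "cantor_set C \<longleftrightarrow> C \<noteq> {} \<and> compact C \<and> (\<forall>x\<in>C. x islimpt C)
     \<and> (\<forall>x\<in>C. connected_component_set C x = {x})"

definition minimal_homeo :: "'a::metric_space set \<Rightarrow> ('a \<Rightarrow> 'a) \<Rightarrow> bool" where
  "minimal_homeo C h \<longleftrightarrow> (\<exists>g. homeomorphism C C h g)
     \<and> (\<forall>K. K \<subseteq> C \<and> closed K \<and> K \<noteq> {} \<and> h ` K \<subseteq> K \<longrightarrow> K = C)"

definition quotient_topology :: "'a topology \<Rightarrow> ('a \<Rightarrow> 'b) \<Rightarrow> 'b topology" where
  "quotient_topology X p =
     topology (\<lambda>U. U \<subseteq> p ` topspace X \<and> openin X {x \<in> topspace X. p x \<in> U})"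

text \<open>The identification (z,1) ~ (h z,0): every class of C \<times> [0,1] has a unique
  representative in C \<times> [0,1), and susp_proj sends a point to it.\<close>
definition susp_proj :: "('a \<Rightarrow> 'a) \<Rightarrow> 'a \<times> real \<Rightarrow> 'a \<times> real" where
  "susp_proj h x = (if snd x = 1 then (h (fst x), 0) else x)"

definition susp_top :: "'a::metric_space set \<Rightarrow> ('a \<Rightarrow> 'a) \<Rightarrow> ('a \<times> real) topology" where
  "susp_top C h = quotient_topology (top_of_set (C \<times> {0..1})) (susp_proj h)"

definition int_iter :: "'a set \<Rightarrow> ('a \<Rightarrow> 'a) \<Rightarrow> int \<Rightarrow> 'a \<Rightarrow> 'a" where
  "int_iter C h k = (if k \<ge> 0 then h ^^ nat k else (inv_into C h) ^^ nat (- k))"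

definition susp_flow :: "'a set \<Rightarrow> ('a \<Rightarrow> 'a) \<Rightarrow> real \<Rightarrow> 'a \<times> real \<Rightarrow> 'a \<times> real" where
  "susp_flow C h s x = (int_iter C h \<lfloor>snd x + s\<rfloor> (fst x), frac (snd x + s))"

definition susp_orbit :: "'a set \<Rightarrow> ('a \<Rightarrow> 'a) \<Rightarrow> 'a \<times> real \<Rightarrow> ('a \<times> real) set" where
  "susp_orbit C h x = range (\<lambda>s. susp_flow C h s x)"

definition flow_equivalent ::
  "'a::metric_space set \<Rightarrow> ('a \<Rightarrow> 'a) \<Rightarrow> 'b::metric_space set \<Rightarrow> ('b \<Rightarrow> 'b) \<Rightarrow> bool" where
  "flow_equivalent C1 h1 C2 h2 \<longleftrightarrow>
     (\<exists>F. homeomorphic_map (susp_top C1 h1) (susp_top C2 h2) F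
        \<and> (\<forall>x\<in>topspace (susp_top C1 h1).
              F ` susp_orbit C1 h1 x = susp_orbit C2 h2 (F x)
            \<and> (\<exists>\<tau>::real \<Rightarrow> real. strict_mono \<tau>
                  \<and> (\<forall>s. F (susp_flow C1 h1 s x) = susp_flow C2 h2 (\<tau> s) (F x)))))"

definition return_time :: "('a \<Rightarrow> 'a) \<Rightarrow> 'a set \<Rightarrow> 'a \<Rightarrow> nat" where
  "return_time h N x = (LEAST k. k \<ge> 1 \<and> (h ^^ k) x \<in> N)"

definition return_map :: "('a \<Rightarrow> 'a) \<Rightarrow> 'a set \<Rightarrow> 'a \<Rightarrow> 'a" where
  "return_map h N x = (h ^^ return_time h N x) x"

definition top_conjugate :: "'a::topological_space set \<Rightarrow> ('a \<Rightarrow> 'a)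
     \<Rightarrow> 'b::topological_space set \<Rightarrow> ('b \<Rightarrow> 'b) \<Rightarrow> bool" where
  "top_conjugate A f B g \<longleftrightarrow>
     (\<exists>\<phi> \<psi>. homeomorphism A B \<phi> \<psi> \<and> (\<forall>x\<in>A. \<phi> (f x) = g (\<phi> x)))"

text \<open>Neighbourhoods are read as nonempty clopen subsets of the Cantor set.\<close>
definition clopen_in :: "'a::topological_space set \<Rightarrow> 'a set \<Rightarrow> bool" where
  "clopen_in C N \<longleftrightarrow> N \<noteq> {} \<and> N \<subseteq> C \<and> openin (top_of_set C) N \<and> closedin (top_of_set C) N"

definition germ_dir ::
  "'a::metric_space set \<Rightarrow> ('a \<Rightarrow> 'a) \<Rightarrow> 'b::metric_space set \<Rightarrow> ('b \<Rightarrow> 'b) \<Rightarrow> bool" where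
  "germ_dir C h C' h' \<longleftrightarrow>
     (\<forall>K. clopen_in C K \<longrightarrow>
        (\<exists>\<delta>>0. \<forall>N'. clopen_in C' N' \<and> diameter N' < \<delta> \<longrightarrow>
           (\<exists>N. clopen_in C N \<and> N \<subseteq> K \<and>
                top_conjugate N (return_map h N) N' (return_map h' N'))))"

definition germinally_equivalent ::
  "'a::metric_space set \<Rightarrow> ('a \<Rightarrow> 'a) \<Rightarrow> 'b::metric_space set \<Rightarrow> ('b \<Rightarrow> 'b) \<Rightarrow> bool" where
  "germinally_equivalent C1 h1 C2 h2 \<longleftrightarrow> germ_dir C1 h1 C2 h2 \<and> germ_dir C2 h2 C1 h1"

end

theory Submission
  imports Defs
begin

text \<open>Everything is done in the covering of the suspension of \<open>h\<close> by \<open>C \<times> \<real>\<close>, an open map that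
  identifies \<open>(x, s)\<close> with \<open>(h\<^sup>n x, s - n)\<close> and turns the flow into translation. If \<open>\<rho>\<close> is the
  return time to a clopen set \<open>N\<close>, then \<open>(x, s) \<mapsto> (x, s \<rho>(x))\<close> induces a flow equivalence from
  the suspension of the return map of \<open>N\<close> to that of \<open>h\<close>; hence a single pair of conjugate return
  maps suffices for flow equivalence. Conversely, given a flow equivalence \<open>G\<close>, the image under
  \<open>G\<close> of a small flow box over \<open>K \<subseteq> C\<close> is again a flow box, since \<open>C'\<close> is totally disconnected
  and flow lines are connected. The intermediate value theorem finds in this box the points that
  \<open>G\<close> maps into \<open>C' \<times> {0}\<close>; they give a homeomorphism \<open>\<psi>\<close> from a clopen \<open>U \<subseteq> K\<close> onto a clopen
  neighbourhood of a prescribed point of \<open>C'\<close>, and as \<open>G\<close> preserves the order of orbits, \<open>\<psi>\<close>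
  conjugates the return maps of corresponding clopen subsets. Compactness of \<open>C'\<close> makes the size
  of the neighbourhoods uniform.\<close>

section \<open>The suspension and its covering\<close>

text \<open>The flow is followed from the base section for time \<open>s\<close>. Over
  \<open>C\<close> the values are the chosen representatives in \<open>C \<times> {0..<1}\<close>,
  so equality of values is equality in the suspension.\<close>

definition susp_cover :: "'a set \<Rightarrow> ('a \<Rightarrow> 'a) \<Rightarrow> 'a \<times> real \<Rightarrow> 'a \<times> real" where
  "susp_cover C h p = susp_flow C h (snd p) (fst p, 0)"

section \<open>Quotient topologies\<close>

lemma istopology_quotient:
  "istopology (\<lambda>U. U \<subseteq> p ` topspace X \<and> openin X {x \<in> topspace X. p x \<in> U})"
  unfolding istopology_def
proof (intro conjI allI impI)
  fix S T
  assume S: "S \<subseteq> p ` topspace X \<and> openin X {x \<in> topspace X. p x \<in> S}"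
    and T: "T \<subseteq> p ` topspace X \<and> openin X {x \<in> topspace X. p x \<in> T}"
  then show "S \<inter> T \<subseteq> p ` topspace X" by blast
  have "{x \<in> topspace X. p x \<in> S \<inter> T} = {x \<in> topspace X. p x \<in> S} \<inter> {x \<in> topspace X. p x \<in> T}"
    by blast
  then show "openin X {x \<in> topspace X. p x \<in> S \<inter> T}"
    using S T by (simp add: openin_Int)
next
  fix \<K>
  assume K: "\<forall>K\<in>\<K>. K \<subseteq> p ` topspace X \<and> openin X {x \<in> topspace X. p x \<in> K}"
  then show "\<Union>\<K> \<subseteq> p ` topspace X" by blast
  have "openin X (\<Union>K\<in>\<K>. {x \<in> topspace X. p x \<in> K})"
    using K by blast
  moreover have "(\<Union>K\<in>\<K>. {x \<in> topspace X. p x \<in> K}) = {x \<in> topspace X. p x \<in> \<Union>\<K>}"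
    by blast
  ultimately show "openin X {x \<in> topspace X. p x \<in> \<Union>\<K>}"
    by simp
qed

lemma openin_quotient_topology:
  "openin (quotient_topology X p) U \<longleftrightarrow> U \<subseteq> p ` topspace X \<and> openin X {x \<in> topspace X. p x \<in> U}"
  unfolding quotient_topology_def by (simp add: topology_inverse' istopology_quotient)

lemma topspace_quotient_topology: "topspace (quotient_topology X p) = p ` topspace X"
proof
  show "topspace (quotient_topology X p) \<subseteq> p ` topspace X"
    by (metis openin_quotient_topology openin_topspace)
  have "{x \<in> topspace X. p x \<in> p ` topspace X} = topspace X" by blast
  then have "openin (quotient_topology X p) (p ` topspace X)"
    by (simp add: openin_quotient_topology)
  then show "p ` topspace X \<subseteq> topspace (quotient_topology X p)"
    by (rule openin_subset)
qed

lemma quotient_map_quotient_topology: "quotient_map X (quotient_topology X p) p"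
  by (auto simp: quotient_map_def topspace_quotient_topology openin_quotient_topology)

section \<open>Integer iterates of a homeomorphism of a compact set\<close>

locale compact_homeo =
  fixes C :: "'a::metric_space set" and h :: "'a \<Rightarrow> 'a"
  assumes compact: "compact C" and homeo: "\<exists>g. homeomorphism C C h g"
begin

abbreviation H where "H \<equiv> int_iter C h"
abbreviation cov where "cov \<equiv> susp_cover C h"
abbreviation \<Sigma> where "\<Sigma> \<equiv> susp_top C h"

lemma bij: "bij_betw h C C"
  using homeo unfolding homeomorphism_def bij_betw_def by (metis inj_on_inverseI)

lemma h_in [simp]: "x \<in> C \<Longrightarrow> h x \<in> C"
  using bij bij_betwE by blast

lemma inv_in [simp]: "x \<in> C \<Longrightarrow> inv_into C h x \<in> C"
  by (metis bij bij_betw_imp_surj_on inv_into_into)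

lemma h_inv [simp]: "x \<in> C \<Longrightarrow> h (inv_into C h x) = x"
  by (metis bij bij_betw_inv_into_right)

lemma inv_h [simp]: "x \<in> C \<Longrightarrow> inv_into C h (h x) = x"
  by (metis bij bij_betw_inv_into_left)

lemma continuous_h: "continuous_on C h"
  using homeo unfolding homeomorphism_def by blast

lemma continuous_inv: "continuous_on C (inv_into C h)"
proof -
  obtain g where g: "homeomorphism C C h g" using homeo by blast
  have "inv_into C h x = g x" if "x \<in> C" for x
    using g that unfolding homeomorphism_def by (metis imageI inv_h)
  moreover have "continuous_on C g" using g unfolding homeomorphism_def by blast
  ultimately show ?thesis by (simp cong: continuous_on_cong)
qed

lemma funpow_in: "x \<in> C \<Longrightarrow> (h ^^ n) x \<in> C"
  by (induction n) auto

lemma funpow_inv_in: "x \<in> C \<Longrightarrow> (inv_into C h ^^ n) x \<in> C"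
  by (induction n) auto

lemma H_in [simp]: "x \<in> C \<Longrightarrow> H k x \<in> C"
  by (simp add: int_iter_def funpow_in funpow_inv_in)

lemma H_0 [simp]: "H 0 x = x" by (simp add: int_iter_def)

lemma H_of_nat: "H (int n) x = (h ^^ n) x" by (simp add: int_iter_def)

lemma H_succ: assumes "x \<in> C" shows "H (k + 1) x = h (H k x)"
proof (cases "k \<ge> 0")
  case True
  then have "nat (k + 1) = Suc (nat k)" by simp
  with True show ?thesis by (simp add: int_iter_def)
next
  case False
  then have "nat (- k) = Suc (nat (- (k + 1)))" by simp
  moreover have "H (k + 1) x = (inv_into C h ^^ nat (- (k + 1))) x"
  \<comment> \<open>At \<open>k = -1\<close> the index \<open>k + 1\<close> falls under the other
    branch of \<open>int_iter\<close>; both branches give the identity there.\<close>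
  proof (cases "k + 1 = 0")
    case True
    then show ?thesis by (simp add: int_iter_def)
  next
    case F: False
    then have "\<not> k + 1 \<ge> 0" using False by simp
    then show ?thesis by (simp add: int_iter_def)
  qed
  moreover have "H k x = (inv_into C h ^^ nat (- k)) x"
    using False by (simp add: int_iter_def)
  ultimately show ?thesis using assms funpow_inv_in by simp
qed

lemma H_1: "x \<in> C \<Longrightarrow> H 1 x = h x"
  using H_succ[of x 0] by simp

lemma H_add: assumes "x \<in> C" shows "H (k + l) x = H k (H l x)"
proof (induction k rule: int_induct[of _ 0])
  case base
  show ?case by simp
next
  case (step1 i)
  then show ?case using H_succ[of x "i + l"] H_succ[of "H l x" i] assms by (simp add: algebra_simps)
next
  case (step2 i)
  have "h (H (i - 1 + l) x) = h (H (i - 1) (H l x))"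
    using step2 H_succ[of x "i - 1 + l"] H_succ[of "H l x" "i - 1"] assms by simp
  then show ?case by (metis H_in assms inv_h)
qed

lemma H_cancel [simp]: "x \<in> C \<Longrightarrow> H k (H (- k) x) = x" "x \<in> C \<Longrightarrow> H (- k) (H k x) = x"
  by (metis H_0 H_add add.right_inverse) (metis H_0 H_add add.left_inverse)

lemma continuous_H: "continuous_on C (H k)"
proof -
  have *: "continuous_on C (f ^^ n)" if f: "continuous_on C f" "\<And>x. x \<in> C \<Longrightarrow> f x \<in> C" for f :: "'a \<Rightarrow> 'a" and n
  proof (induction n)
    case (Suc n)
    have "(f ^^ n) ` C \<subseteq> C"
    proof (induction n)
      case (Suc n) then show ?case using f(2) by auto
    qed auto
    then show ?case using Suc f(1) continuous_on_compose[of C "f ^^ n" f]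
      by (auto intro: continuous_on_subset)
  qed (simp add: id_def)
  show ?thesis unfolding int_iter_def
    using *[OF continuous_h] *[OF continuous_inv] by (cases "k \<ge> 0") auto
qed

section \<open>The covering map and its deck translations\<close>

lemma cov_eq: "cov (x, s) = (H \<lfloor>s\<rfloor> x, frac s)"
  by (simp add: susp_cover_def susp_flow_def)

lemma cov_shift: "x \<in> C \<Longrightarrow> cov (H n x, s) = cov (x, s + n)"
  by (simp add: cov_eq H_add frac_def)

lemma flow_cov: assumes "x \<in> C" shows "susp_flow C h s (cov (x, t)) = cov (x, t + s)"
proof -
  have "\<lfloor>t + s\<rfloor> = \<lfloor>frac t + s\<rfloor> + \<lfloor>t\<rfloor>" by (simp add: frac_def algebra_simps)
  moreover have "frac (t + s) = frac (frac t + s)" by (simp add: frac_def algebra_simps)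
  ultimately show ?thesis using assms by (simp add: cov_eq susp_flow_def H_add)
qed

lemma cov_eq_iff: assumes "x \<in> C" "y \<in> C"
  shows "cov (x, s) = cov (y, t) \<longleftrightarrow> (\<exists>n. y = H n x \<and> s = t + of_int n)"
proof
  assume L: "cov (x, s) = cov (y, t)"
  define n where "n = \<lfloor>s\<rfloor> - \<lfloor>t\<rfloor>"
  have "s = t + of_int n" using L unfolding cov_eq n_def frac_def by simp
  moreover have "y = H (- \<lfloor>t\<rfloor>) (H \<lfloor>t\<rfloor> y)" using assms by simp
  moreover have "H (- \<lfloor>t\<rfloor>) (H \<lfloor>s\<rfloor> x) = H n x"
    using H_add[of x "- \<lfloor>t\<rfloor>" "\<lfloor>s\<rfloor>"] assms by (simp add: n_def)
  ultimately show "\<exists>n. y = H n x \<and> s = t + of_int n" using L unfolding cov_eq by auto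
next
  assume "\<exists>n. y = H n x \<and> s = t + of_int n"
  then show "cov (x, s) = cov (y, t)" using assms cov_shift by auto
qed

lemma cov_fundamental: "x \<in> C \<Longrightarrow> 0 \<le> s \<Longrightarrow> s < 1 \<Longrightarrow> cov (x, s) = (x, s)"
  using floor_unique[of 0 s] by (simp add: cov_eq frac_def)

lemma susp_proj_cov: assumes "x \<in> C" "0 \<le> s" "s \<le> 1" shows "susp_proj h (x, s) = cov (x, s)"
proof (cases "s = 1")
  case True
  then show ?thesis using assms by (simp add: susp_proj_def cov_eq H_1)
next
  case False
  then show ?thesis using assms cov_fundamental by (simp add: susp_proj_def)
qed

lemma topspace_susp: "topspace \<Sigma> = C \<times> {0..<1}"
proof -
  have "susp_proj h ` (C \<times> {0..1}) = C \<times> {0..<1}"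
    by (force simp: susp_proj_def image_iff)
  then show ?thesis by (simp add: susp_top_def topspace_quotient_topology)
qed

lemma cov_in [simp]: "x \<in> C \<Longrightarrow> cov (x, s) \<in> topspace \<Sigma>"
  by (simp add: topspace_susp cov_eq frac_lt_1)

lemma topspace_cov: "p \<in> topspace \<Sigma> \<Longrightarrow> fst p \<in> C \<and> cov p = p"
  unfolding topspace_susp using cov_fundamental by (cases p) auto

lemma cov_image: "cov ` (C \<times> UNIV) = topspace \<Sigma>"
proof
  show "cov ` (C \<times> UNIV) \<subseteq> topspace \<Sigma>" by auto
  show "topspace \<Sigma> \<subseteq> cov ` (C \<times> UNIV)"
  proof
    fix p assume "p \<in> topspace \<Sigma>"
    then have "fst p \<in> C" "cov p = p" using topspace_cov by blast+
    then show "p \<in> cov ` (C \<times> UNIV)"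
      by (metis SigmaI UNIV_I imageI prod.collapse)
  qed
qed

lemma cov_cases:
  assumes "p \<in> topspace \<Sigma>" obtains x s where "x \<in> C" "p = cov (x, s)"
proof (rule that)
  show "fst p \<in> C" using assms topspace_cov by blast
  show "p = cov (fst p, snd p)" using topspace_cov[OF assms] by (simp only: prod.collapse)
qed

lemma continuous_shift: "continuous_on (C \<times> UNIV) (\<lambda>p. (H n (fst p), snd p - of_int n :: real))"
  by (intro continuous_intros continuous_on_compose2[OF continuous_H]) auto

text \<open>On the unit slab \<open>susp_proj\<close> and \<open>cov\<close> agree, so openness in
  the suspension can be tested with the covering.\<close>

lemma openin_susp:
  assumes "U \<subseteq> topspace \<Sigma>"
  shows "openin \<Sigma> U \<longleftrightarrow> openin (top_of_set (C \<times> {0..1})) {p \<in> C \<times> {0..1}. cov p \<in> U}"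
proof -
  have "{p \<in> C \<times> {0..1}. susp_proj h p \<in> U} = {p \<in> C \<times> {0..1}. cov p \<in> U}"
    using susp_proj_cov by force
  then show ?thesis using assms
    unfolding susp_top_def openin_quotient_topology topspace_quotient_topology by simp
qed

text \<open>Seen in the unit slab, the saturation of \<open>U\<close> is the union of its preimages
  under all deck translations \<open>?sh n\<close>, each of which is continuous.\<close>

lemma open_cov:
  assumes U: "openin (top_of_set (C \<times> UNIV)) U"
  shows "openin \<Sigma> (cov ` U)"
proof -
  let ?sh = "\<lambda>n p. (H n (fst p), snd p - real_of_int n)"
  have UC: "U \<subseteq> C \<times> UNIV" using U openin_imp_subset by blast
  then have sub: "cov ` U \<subseteq> topspace \<Sigma>" using cov_image by blast
  have "{p \<in> C \<times> {0..1}. cov p \<in> cov ` U} = (\<Union>n. {p \<in> C \<times> {0..1}. ?sh n p \<in> U})"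
  proof (intro set_eqI iffI)
    fix p assume "p \<in> {p \<in> C \<times> {0..1}. cov p \<in> cov ` U}"
    then obtain q where p: "p \<in> C \<times> {0..1}" and q: "q \<in> U" "cov p = cov q" by blast
    then have "fst p \<in> C" "fst q \<in> C" using UC by auto
    then obtain n where "fst q = H n (fst p)" "snd p = snd q + of_int n"
      using cov_eq_iff[of "fst p" "fst q" "snd p" "snd q"] q by auto
    then have "?sh n p = q" by (simp add: prod_eq_iff)
    then show "p \<in> (\<Union>n. {p \<in> C \<times> {0..1}. ?sh n p \<in> U})" using p q by auto
  next
    fix p assume "p \<in> (\<Union>n. {p \<in> C \<times> {0..1}. ?sh n p \<in> U})"
    then obtain n where p: "p \<in> C \<times> {0..1}" "?sh n p \<in> U" by auto
    have "cov p = cov (?sh n p)" using p cov_shift[of "fst p" n "snd p - of_int n"] by auto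
    then show "p \<in> {p \<in> C \<times> {0..1}. cov p \<in> cov ` U}" using p by auto
  qed
  moreover have "openin (top_of_set (C \<times> {0..1})) {p \<in> C \<times> {0..1}. ?sh n p \<in> U}" for n
  proof -
    have "continuous_on (C \<times> {0..1}) (?sh n)"
      by (rule continuous_on_subset[OF continuous_shift]) auto
    moreover have "?sh n \<in> (C \<times> {0..1}) \<rightarrow> C \<times> UNIV" by auto
    ultimately have "openin (top_of_set (C \<times> {0..1})) ((C \<times> {0..1}) \<inter> ?sh n -` U)"
      using U continuous_openin_preimage by blast
    then show ?thesis by (simp add: vimage_def Int_def)
  qed
  ultimately show ?thesis unfolding openin_susp[OF sub] by auto
qed

lemma continuous_cov_unit: "continuous_map (top_of_set (C \<times> {0..1})) \<Sigma> cov"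
  unfolding continuous_map_def
proof (intro conjI allI impI)
  show "cov \<in> topspace (top_of_set (C \<times> {0..1})) \<rightarrow> topspace \<Sigma>" by auto
  fix U assume "openin \<Sigma> U"
  then show "openin (top_of_set (C \<times> {0..1})) {x \<in> topspace (top_of_set (C \<times> {0..1})). cov x \<in> U}"
    using openin_susp openin_subset by auto
qed

text \<open>The slabs over the intervals from \<open>n\<close> to \<open>n + 1\<close> form a
  locally finite closed cover. On each of them \<open>cov\<close> is a deck translation to the unit
  slab followed by the restriction of \<open>cov\<close> already known to be continuous.\<close>

lemma continuous_cov: "continuous_map (top_of_set (C \<times> UNIV)) \<Sigma> cov"
proof (rule pasting_lemma_locally_finite[where I = UNIV and T = "\<lambda>n::int. C \<times> {of_int n .. of_int n + 1}" and f = "\<lambda>_. cov"])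
  fix p :: "'a \<times> real"
  assume p: "p \<in> topspace (top_of_set (C \<times> UNIV))"
  let ?V = "C \<times> {snd p - 1 <..< snd p + 1}"
  have "openin (top_of_set (C \<times> UNIV)) ?V"
    by (intro openin_Times) auto
  moreover have "p \<in> ?V" using p by (cases p) auto
  moreover have "{i. C \<times> {real_of_int i..real_of_int i + 1} \<inter> ?V \<noteq> {}} \<subseteq> {\<lfloor>snd p\<rfloor> - 3 .. \<lfloor>snd p\<rfloor> + 3}"
    by auto linarith+
  then have "finite {i. C \<times> {real_of_int i..real_of_int i + 1} \<inter> ?V \<noteq> {}}"
    using finite_subset by blast
  ultimately show "\<exists>V. openin (top_of_set (C \<times> UNIV)) V \<and> p \<in> V \<and>
      finite {i \<in> UNIV. C \<times> {real_of_int i..real_of_int i + 1} \<inter> V \<noteq> {}}"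
    by auto
next
  fix n :: int
  let ?T = "C \<times> {real_of_int n..real_of_int n + 1}" and ?sh = "\<lambda>p. (H n (fst p), snd p - real_of_int n)"
  show "closedin (top_of_set (C \<times> UNIV)) ?T"
    by (intro closedin_Times) auto
  have "continuous_on ?T ?sh" by (rule continuous_on_subset[OF continuous_shift]) auto
  then have "continuous_map (top_of_set ?T) (top_of_set (C \<times> {0..1})) ?sh" by auto
  then have "continuous_map (top_of_set ?T) \<Sigma> (cov \<circ> ?sh)"
    using continuous_cov_unit continuous_map_compose by blast
  moreover have "(cov \<circ> ?sh) p = cov p" if "p \<in> ?T" for p
    using that cov_shift[of "fst p" n "snd p - of_int n"] by auto
  ultimately have "continuous_map (top_of_set ?T) \<Sigma> cov"
    by (rule continuous_map_eq) auto
  then show "continuous_map (subtopology (top_of_set (C \<times> UNIV)) ?T) \<Sigma> cov"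
    by (simp add: subtopology_subtopology Int_absorb1 Sigma_mono)
next
  fix p :: "'a \<times> real" assume "p \<in> topspace (top_of_set (C \<times> UNIV))"
  then show "\<exists>j. j \<in> UNIV \<and> p \<in> C \<times> {real_of_int j..real_of_int j + 1} \<and> cov p = cov p"
    by (intro exI[of _ "\<lfloor>snd p\<rfloor>"]) (auto simp: mem_Times_iff)
qed auto

lemma quotient_cov_unit: "quotient_map (top_of_set (C \<times> {0..1})) \<Sigma> cov"
proof -
  have "quotient_map (top_of_set (C \<times> {0..1})) \<Sigma> (susp_proj h)"
    unfolding susp_top_def by (rule quotient_map_quotient_topology)
  then show ?thesis by (rule quotient_map_eq) (auto simp: susp_proj_cov)
qed

section \<open>Compactness and separation of the suspension\<close>

lemma compact_susp: "compact_space \<Sigma>"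
proof -
  have "compactin (top_of_set (C \<times> {0..1::real})) (C \<times> {0..1})"
    using compact by (simp add: compact_Times compactin_subtopology)
  then have "compactin \<Sigma> (cov ` (C \<times> {0..1}))"
    using continuous_cov_unit by (rule image_compactin)
  moreover have "cov ` (C \<times> {0..1}) = topspace \<Sigma>"
    using quotient_imp_surjective_map[OF quotient_cov_unit] by simp
  ultimately show ?thesis by (simp add: compact_space_def)
qed

text \<open>If the images of all small boxes around two lifts met, there would be points
  \<open>a k\<close> and \<open>b k\<close> converging to the lifts and related by deck translations
  \<open>n k\<close>. The integers \<open>n k\<close> are differences of convergent heights, hence
  eventually constant, and in the limit the two lifts are related as well. With compactness this
  lets later constructions of homeomorphisms stop at continuous bijections.\<close>

lemma Hausdorff_susp: "Hausdorff_space \<Sigma>"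
  unfolding Hausdorff_space_def
proof (intro allI impI)
  fix p q assume pq: "p \<in> topspace \<Sigma> \<and> q \<in> topspace \<Sigma> \<and> p \<noteq> q"
  obtain x s where x: "x \<in> C" "p = cov (x, s)" using cov_cases[of p] pq by blast
  obtain y t where y: "y \<in> C" "q = cov (y, t)" using cov_cases[of q] pq by blast
  define A where "A k = (C \<inter> ball x (inverse (Suc k))) \<times> ball s (inverse (Suc k))" for k
  define B where "B k = (C \<inter> ball y (inverse (Suc k))) \<times> ball t (inverse (Suc k))" for k
  have op: "openin (top_of_set (C \<times> UNIV)) (A k)" "openin (top_of_set (C \<times> UNIV)) (B k)" for k
    unfolding A_def B_def by (auto intro!: openin_Times)
  have "\<exists>k. cov ` A k \<inter> cov ` B k = {}"
  proof (rule ccontr)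
    assume "\<not> ?thesis"
    then have "\<forall>k. \<exists>ab. fst ab \<in> A k \<and> snd ab \<in> B k \<and> cov (fst ab) = cov (snd ab)" by force
    then obtain f where f: "\<forall>k. fst (f k) \<in> A k \<and> snd (f k) \<in> B k \<and> cov (fst (f k)) = cov (snd (f k))"
      by (rule choice[THEN exE])
    define a b where "a = fst \<circ> f" and "b = snd \<circ> f"
    have ab: "\<And>k. a k \<in> A k" "\<And>k. b k \<in> B k" "\<And>k. cov (a k) = cov (b k)"
      using f by (simp_all add: a_def b_def)
    have C: "fst (a k) \<in> C" "fst (b k) \<in> C" for k
      using ab(1)[of k] ab(2)[of k] unfolding A_def B_def by auto
    have "\<forall>k. \<exists>n. fst (b k) = H n (fst (a k)) \<and> snd (a k) = snd (b k) + of_int n"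
    proof
      fix k show "\<exists>n. fst (b k) = H n (fst (a k)) \<and> snd (a k) = snd (b k) + of_int n"
      using cov_eq_iff[OF C(1)[of k] C(2)[of k], of "snd (a k)" "snd (b k)"] ab(3)[of k] by simp
    qed
    then obtain n where n': "\<forall>k. fst (b k) = H (n k) (fst (a k)) \<and> snd (a k) = snd (b k) + of_int (n k)"
      by (rule choice[THEN exE])
    then have n: "\<And>k. fst (b k) = H (n k) (fst (a k))" "\<And>k. snd (a k) = snd (b k) + of_int (n k)"
      by blast+
    have "(\<lambda>k. 1 / real (Suc k)) \<longlonglongrightarrow> 0" by (rule lim_1_over_n[THEN LIMSEQ_Suc])
    then have inv0: "(\<lambda>k. inverse (real (Suc k))) \<longlonglongrightarrow> 0" by (simp add: inverse_eq_divide)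
    have d: "dist (fst (a k)) x < inverse (Suc k)" "dist (snd (a k)) s < inverse (Suc k)"
      "dist (fst (b k)) y < inverse (Suc k)" "dist (snd (b k)) t < inverse (Suc k)" for k
      using ab(1)[of k] ab(2)[of k] unfolding A_def B_def mem_Times_iff Int_iff mem_ball
      by (simp_all only: dist_commute)
    have lim: "f \<longlonglongrightarrow> z" if "\<And>k. dist (f k) z < inverse (Suc k)" for f and z :: "'c::metric_space"
      by (rule metric_tendsto_imp_tendsto[OF inv0], rule always_eventually, rule allI)
         (use that in \<open>simp add: less_imp_le\<close>)
    have l: "(\<lambda>k. fst (a k)) \<longlonglongrightarrow> x" by (rule lim) (rule d)
    have l2: "(\<lambda>k. snd (a k)) \<longlonglongrightarrow> s" by (rule lim) (rule d)
    have l3: "(\<lambda>k. fst (b k)) \<longlonglongrightarrow> y" by (rule lim) (rule d)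
    have l4: "(\<lambda>k. snd (b k)) \<longlonglongrightarrow> t" by (rule lim) (rule d)
    have nl: "(\<lambda>k. real_of_int (n k)) \<longlonglongrightarrow> s - t"
      using tendsto_diff[OF l2 l4] n(2) by simp
    then have "Cauchy (\<lambda>k. real_of_int (n k))" by (rule LIMSEQ_imp_Cauchy)
    then obtain M where "\<And>k l. k \<ge> M \<Longrightarrow> l \<ge> M \<Longrightarrow> dist (real_of_int (n k)) (real_of_int (n l)) < 1"
      unfolding Cauchy_def by (meson zero_less_one)
    then have const: "n k = n M" if "k \<ge> M" for k
    proof -
      have "\<bar>real_of_int (n k - n M)\<bar> < 1"
        using \<open>\<And>k l. k \<ge> M \<Longrightarrow> l \<ge> M \<Longrightarrow> _\<close>[OF that order.refl] by (simp add: dist_real_def)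
      then show ?thesis by linarith
    qed
    then have ev: "\<forall>\<^sub>F k in sequentially. n k = n M"
      using eventually_sequentially by blast
    then have "(\<lambda>k. real_of_int (n k)) \<longlonglongrightarrow> of_int (n M)"
      by (simp add: tendsto_eventually eventually_mono)
    then have st: "s = t + of_int (n M)" using LIMSEQ_unique[OF nl] by fastforce
    have "(\<lambda>k. H (n M) (fst (a k))) \<longlonglongrightarrow> H (n M) x"
      by (rule continuous_on_tendsto_compose[OF continuous_H l x(1)]) (simp add: C)
    moreover have "\<forall>\<^sub>F k in sequentially. H (n M) (fst (a k)) = fst (b k)"
      using ev by eventually_elim (simp add: n)
    ultimately have "(\<lambda>k. fst (b k)) \<longlonglongrightarrow> H (n M) x"
      by (rule Lim_transform_eventually)
    then have "y = H (n M) x" using LIMSEQ_unique l3 by blast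
    then have "p = q" unfolding x(2) y(2) using cov_eq_iff[OF x(1) y(1)] st by blast
    then show False using pq by blast
  qed
  then obtain k where "cov ` A k \<inter> cov ` B k = {}" by blast
  moreover have "(x, s) \<in> A k" "(y, t) \<in> B k" using x(1) y(1) by (simp_all add: A_def B_def)
  then have "p \<in> cov ` A k" "q \<in> cov ` B k" unfolding x(2) y(2) by (simp_all only: imageI)
  ultimately show "\<exists>U V. openin \<Sigma> U \<and> openin \<Sigma> V \<and> p \<in> U \<and> q \<in> V \<and> disjnt U V"
    using open_cov[OF op(1)[of k]] open_cov[OF op(2)[of k]] unfolding disjnt_def
    by (intro exI[of _ "cov ` A k"] exI[of _ "cov ` B k"] conjI)
qed

end

section \<open>Minimal homeomorphisms and return maps\<close>

lemma int_step_mono: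
  fixes a :: "int \<Rightarrow> int"
  assumes "\<And>n. a n < a (n + 1)" and "m \<le> n"
  shows "a m + (n - m) \<le> a n"
  using \<open>m \<le> n\<close>
proof (induction n rule: int_ge_induct)
  case (step i)
  then show ?case using assms(1)[of i] by simp
qed simp

lemma int_step_bracket:
  fixes a :: "int \<Rightarrow> int" and m :: int
  assumes a: "\<And>n. a n < a (n + 1)"
  shows "\<exists>n. a n \<le> m \<and> m < a (n + 1)"
proof -
  \<comment> \<open>Each step of \<open>a\<close> is at least 1, so going back from index 0 by
    \<open>a 0 - m\<close> steps (if this is positive) brings the value down to at most
    \<open>m\<close>.\<close>
  define n0 where "n0 = min 0 (m - a 0)"
  have n0: "a n0 \<le> m" using int_step_mono[of a n0 0, OF a] by (simp add: n0_def)
  define P where "P k \<longleftrightarrow> m < a (n0 + int k + 1)" for k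
  have "P (nat (m - a n0))"
    using int_step_mono[of a n0 "n0 + int (nat (m - a n0)) + 1", OF a] n0 by (simp add: P_def)
  then have P: "P (LEAST k. P k)" by (rule LeastI)
  have "a (n0 + int (LEAST k. P k)) \<le> m"
  proof (cases "LEAST k. P k")
    case 0
    then show ?thesis using n0 by simp
  next
    case (Suc j)
    then have "\<not> P j" using not_less_Least[of j P] by simp
    then show ?thesis using Suc by (simp add: P_def algebra_simps)
  qed
  then show ?thesis using P unfolding P_def by blast
qed

text \<open>Piecewise linear interpolation of \<open>a\<close>: the time change along an orbit between the suspensions
  of a return map and of the original map.\<close>

lemma interpolate_steps:
  fixes a :: "int \<Rightarrow> int" and A :: "real \<Rightarrow> real"
  assumes a: "\<And>n. a n < a (n + 1)"
    and A: "\<And>s. A s = a \<lfloor>s\<rfloor> + frac s * (a (\<lfloor>s\<rfloor> + 1) - a \<lfloor>s\<rfloor>)"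
  shows "strict_mono A" "surj A"
proof -
  have mono: "a m \<le> a n" if "m \<le> n" for m n using int_step_mono[of a, OF a that] that by simp
  show "strict_mono A"
  proof (rule strict_monoI)
    fix s t :: real assume "s < t"
    have pos: "real_of_int (a (n + 1) - a n) > 0" for n using a[of n] by simp
    show "A s < A t"
    proof (cases "\<lfloor>s\<rfloor> = \<lfloor>t\<rfloor>")
      case True
      then have "frac s < frac t" using \<open>s < t\<close> by (simp add: frac_def)
      then show ?thesis using pos[of "\<lfloor>t\<rfloor>"] True by (simp add: A)
    next
      case False
      then have "\<lfloor>s\<rfloor> + 1 \<le> \<lfloor>t\<rfloor>" using \<open>s < t\<close> floor_mono[of s t] by simp
      then have "real_of_int (a (\<lfloor>s\<rfloor> + 1)) \<le> a \<lfloor>t\<rfloor>" using mono by simp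
      moreover have "frac s * (a (\<lfloor>s\<rfloor> + 1) - a \<lfloor>s\<rfloor>) < 1 * real_of_int (a (\<lfloor>s\<rfloor> + 1) - a \<lfloor>s\<rfloor>)"
        using pos[of "\<lfloor>s\<rfloor>"] by (intro mult_strict_right_mono) (auto simp: frac_lt_1)
      then have "A s < a (\<lfloor>s\<rfloor> + 1)" by (simp add: A)
      moreover have "a \<lfloor>t\<rfloor> \<le> A t"
        using mult_nonneg_nonneg[of "frac t" "real_of_int (a (\<lfloor>t\<rfloor> + 1) - a \<lfloor>t\<rfloor>)"] pos[of "\<lfloor>t\<rfloor>"] by (simp add: A)
      ultimately show ?thesis by linarith
    qed
  qed
  show "surj A"
    unfolding surj_def
  proof
    fix t :: real
    obtain n where n: "a n \<le> \<lfloor>t\<rfloor>" "\<lfloor>t\<rfloor> < a (n + 1)"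
      using int_step_bracket[of a "\<lfloor>t\<rfloor>"] a by blast
    then have n': "a n \<le> t" "t < a (n + 1)" by linarith+
    define u where "u = (t - a n) / (a (n + 1) - a n)"
    have u: "0 \<le> u" "u < 1" using n' by (simp_all add: u_def field_simps)
    then have "\<lfloor>n + u\<rfloor> = n" "frac (n + u) = u"
      by (simp_all add: frac_def floor_unique)
    then have "A (n + u) = a n + u * (a (n + 1) - a n)" by (simp add: A)
    also have "\<dots> = t" using n' by (simp add: u_def)
    finally show "\<exists>s. t = A s" by metis
  qed
qed

lemma bi_infinite_partial_sums:
  fixes d :: "int \<Rightarrow> int"
  obtains a where "a 0 = 0" and "\<And>n. a (n + 1) = a n + d n"
proof -
  \<comment> \<open>At most one of the sums is nonempty, according to the sign of
    \<open>n\<close>.\<close>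
  define a where "a n = (\<Sum>i\<in>{0..<n}. d i) - (\<Sum>i\<in>{n..<0}. d i)" for n
  have "a 0 = 0" by (simp add: a_def)
  moreover have "a (n + 1) = a n + d n" for n
  proof (cases "n \<ge> 0")
    case True
    then have "{0..<n + 1} = insert n {0..<n}" by auto
    with True show ?thesis by (simp add: a_def)
  next
    case False
    then have "{n..<0} = insert n {n + 1..<0}" by auto
    with False show ?thesis by (simp add: a_def)
  qed
  ultimately show ?thesis using that by blast
qed

context compact_homeo
begin

lemma openin_H_vimage:
  assumes "openin (top_of_set C) N"
  shows "openin (top_of_set C) {y \<in> C. H k y \<in> N}"
proof -
  have "openin (top_of_set C) (C \<inter> H k -` N)"
    using continuous_openin_preimage[OF continuous_H, of k C N] assms by auto
  then show ?thesis by (simp add: vimage_def Int_def)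
qed

end

section \<open>Aperiodicity, recurrence and clopen neighbourhoods\<close>

locale cantor_minimal =
  fixes C :: "'a::metric_space set" and h :: "'a \<Rightarrow> 'a"
  assumes cantor: "cantor_set C" and minimal: "minimal_homeo C h"
begin

sublocale compact_homeo
  using cantor minimal by unfold_locales (auto simp: cantor_set_def minimal_homeo_def)

lemma closed_C: "closed C" using compact compact_imp_closed by blast

lemma minimalD: "K \<subseteq> C \<Longrightarrow> closed K \<Longrightarrow> K \<noteq> {} \<Longrightarrow> h ` K \<subseteq> K \<Longrightarrow> K = C"
  using minimal unfolding minimal_homeo_def by blast

text \<open>A periodic orbit would be a finite, hence closed, invariant set and so all of
  \<open>C\<close> by minimality; but a Cantor set has no isolated points.\<close>

lemma free:
  assumes x: "x \<in> C" and "H n x = x"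
  shows "n = 0"
proof (rule ccontr)
  assume "n \<noteq> 0"
  define m where "m = \<bar>n\<bar>"
  have m: "m > 0" using \<open>n \<noteq> 0\<close> by (simp add: m_def)
  have "H (- n) x = x" using H_cancel(2)[OF x, of n] assms(2) by simp
  then have Hm: "H m x = x" using assms(2) by (simp add: m_def abs_if)
  define K where "K = (\<lambda>i. H i x) ` {0..<m}"
  have "h y \<in> K" if y: "y \<in> K" for y
  proof -
    obtain i where i: "0 \<le> i" "i < m" "y = H i x" using y by (auto simp: K_def)
    then have hy: "h y = H (i + 1) x" using H_succ x by simp
    show ?thesis
    proof (cases "i + 1 = m")
      case True
      then have "h y = H 0 x" using hy Hm by simp
      then show ?thesis unfolding K_def using m by (intro image_eqI[of _ _ 0]) auto
    next
      case False
      then show ?thesis unfolding K_def using hy i by (intro image_eqI[of _ _ "i + 1"]) auto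
    qed
  qed
  moreover have "finite K" "K \<subseteq> C" "K \<noteq> {}" using x m by (auto simp: K_def)
  ultimately have "K = C" using finite_imp_closed by (intro minimalD) auto
  then have "finite C" using \<open>finite K\<close> by simp
  moreover have "x islimpt C" using cantor x by (simp add: cantor_set_def)
  ultimately show False using islimpt_finite by blast
qed

text \<open>Since no orbit is periodic, flow lines do not close up. This is how times are recovered
  from points below.\<close>

lemma cov_inj: "x \<in> C \<Longrightarrow> cov (x, s) = cov (x, t) \<Longrightarrow> s = t"
  using cov_eq_iff[of x x s t] free by fastforce

text \<open>The points that never enter \<open>N\<close> at a positive time form a closed set mapped
  into itself. If it were nonempty, it would be all of \<open>C\<close>, yet it misses the preimage
  of any point of \<open>N\<close>.\<close>

lemma forward_hit:
  assumes N: "clopen_in C N" and x: "x \<in> C"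
  shows "\<exists>k\<ge>1. (h ^^ k) x \<in> N"
proof (rule ccontr)
  assume no: "\<not> ?thesis"
  define K where "K = C - (\<Union>k\<in>{1..}. {y \<in> C. H (int k) y \<in> N})"
  have K_iff: "y \<in> K \<longleftrightarrow> y \<in> C \<and> (\<forall>k\<ge>1. H (int k) y \<notin> N)" for y
    unfolding K_def by auto
  have NC: "N \<subseteq> C" "N \<noteq> {}" "openin (top_of_set C) N" using N by (auto simp: clopen_in_def)
  have "openin (top_of_set C) (\<Union>k\<in>{1..}. {y \<in> C. H (int k) y \<in> N})"
    using openin_H_vimage NC by blast
  then have "closedin (top_of_set C) K" unfolding K_def by (simp add: closedin_diff)
  then have "closed K" using closed_C closedin_closed_trans by blast
  moreover have "x \<in> K" using x no unfolding K_iff H_of_nat by blast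
  moreover have "h ` K \<subseteq> K"
  proof
    fix z assume "z \<in> h ` K"
    then obtain y where y: "y \<in> K" "z = h y" by blast
    have "H (int k) z \<notin> N" if "k \<ge> 1" for k
    proof -
      have "H (int k) z = H (int (Suc k)) y"
        using y by (simp only: H_of_nat funpow_Suc_right o_apply)
      then show ?thesis using y(1) le_SucI[OF that] unfolding K_iff by metis
    qed
    moreover have "z \<in> C" using y unfolding K_iff by simp
    ultimately show "z \<in> K" unfolding K_iff by blast
  qed
  ultimately have "K = C" by (intro minimalD) (auto simp: K_def)
  obtain z where z: "z \<in> N" "z \<in> C" using NC by blast
  then have "inv_into C h z \<in> K" using \<open>K = C\<close> by simp
  then have "H (int 1) (inv_into C h z) \<notin> N" unfolding K_iff by blast
  then show False using z by (simp add: H_1)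
qed

text \<open>Minimality is phrased with forward images, so backward recurrence is extracted from
  forward recurrence by compactness. It will make the return map surjective.\<close>

lemma backward_hit:
  assumes N: "clopen_in C N" and x: "x \<in> C"
  shows "\<exists>k\<ge>1. H (- k) x \<in> N"
proof -
  define V where "V k = {y \<in> C. H (int k) y \<in> N}" for k
  have "openin (top_of_set C) (V k)" for k
    unfolding V_def using openin_H_vimage N by (auto simp: clopen_in_def)
  then have "\<forall>c\<in>range V. openin (top_of_set C) c" by blast
  moreover have "C \<subseteq> \<Union> (range V)"
    using forward_hit[OF N] unfolding V_def H_of_nat by blast
  ultimately obtain D where D: "D \<subseteq> range V" "finite D" "C \<subseteq> \<Union>D"
    using compact[unfolded compact_eq_openin_cover, rule_format, of "range V"] by blast
  then obtain I where I: "finite I" "D = V ` I" using finite_subset_image by meson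
  txt \<open>Return times to \<open>N\<close> are bounded by \<open>M\<close>, so starting \<open>M + 1\<close> steps earlier hits \<open>N\<close> in time.\<close>
  define M where "M = Max (insert 0 I)"
  have "H (- int (M + 1)) x \<in> \<Union>D" using D(3) H_in[OF x] by blast
  then obtain k where k: "k \<in> I" "H (int k) (H (- int (M + 1)) x) \<in> N" using I by (auto simp: V_def)
  have "k \<le> M" unfolding M_def using I k by (intro Max_ge) auto
  moreover have "H (- (int M + 1 - int k)) x \<in> N" using k H_add[OF x, of "int k" "- int (M + 1)"] by (simp add: algebra_simps)
  ultimately show ?thesis by (intro exI[of _ "int M + 1 - int k"]) auto
qed

text \<open>In a compact Hausdorff space every component has a basis of clopen neighbourhoods, and
  here the components are points.\<close>

lemma clopen_basis:
  assumes x: "x \<in> W" and W: "openin (top_of_set C) W"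
  obtains U where "clopen_in C U" "x \<in> U" "U \<subseteq> W"
proof -
  let ?X = "top_of_set C"
  have xC: "x \<in> C" using x W openin_imp_subset by blast
  have "connected_component_of_set ?X x = connected_component_set C x"
    by (auto simp: connected_component_of_def connected_component_def connectedin_subtopology)
  also have "\<dots> = {x}" using cantor xC by (simp add: cantor_set_def)
  finally have "{x} \<in> connected_components_of ?X"
    using xC by (auto simp: connected_components_of_def intro: image_eqI)
  moreover have "compact_space ?X" using compact by (simp add: compact_space_subtopology)
  then have "locally_compact_space ?X" by (rule compact_imp_locally_compact_space)
  moreover have "Hausdorff_space ?X" by (simp add: Hausdorff_space_subtopology Hausdorff_space_euclidean)
  moreover have "compactin ?X {x}" using xC by simp
  ultimately obtain U V where U: "openin ?X U" "openin ?X V" "disjnt U V" "U \<union> V = topspace ?X" "{x} \<subseteq> U" "U \<subseteq> W"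
    using wilder_locally_compact_component_thm[of ?X "{x}" W] W x by auto
  have "U = topspace ?X - V" using U(3,4) by (auto simp: disjnt_def)
  then have "closedin ?X U" using U(2) by (simp add: closedin_diff)
  then have "clopen_in C U" using U openin_imp_subset[OF U(1)] x by (auto simp: clopen_in_def)
  then show ?thesis using that U by blast
qed

end

section \<open>The first-return map to a clopen set\<close>

locale return_system = cantor_minimal +
  fixes N :: "'a set"
  assumes N: "clopen_in C N"
begin

abbreviation \<rho> where "\<rho> \<equiv> return_time h N"
abbreviation r where "r \<equiv> return_map h N"

lemma N_sub: "x \<in> N \<Longrightarrow> x \<in> C" using N by (auto simp: clopen_in_def)

lemma \<rho>_pos: "x \<in> C \<Longrightarrow> \<rho> x \<ge> 1"
  and return_in: "x \<in> C \<Longrightarrow> H (int (\<rho> x)) x \<in> N"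
  using LeastI_ex[OF forward_hit[OF N, of x, unfolded Bex_def]]
  unfolding return_time_def H_of_nat by blast+

lemma no_earlier_return: "0 < k \<Longrightarrow> k < int (\<rho> x) \<Longrightarrow> H k x \<notin> N"
  using not_less_Least[of "nat k" "\<lambda>k. k \<ge> 1 \<and> (h ^^ k) x \<in> N"] H_of_nat[of "nat k" x]
  unfolding return_time_def by auto

lemma r_eq: "r x = H (int (\<rho> x)) x" by (simp add: return_map_def H_of_nat)

text \<open>Being in \<open>N\<close> at time \<open>\<rho> x\<close> and outside \<open>N\<close>
  at the finitely many earlier positive times is an open condition, because both \<open>N\<close>
  and its complement are open.\<close>

lemma \<rho>_locally_constant:
  assumes x: "x \<in> C"
  shows "\<exists>T. openin (top_of_set C) T \<and> x \<in> T \<and> (\<forall>y\<in>T. \<rho> y = \<rho> x)"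
proof -
  have op: "openin (top_of_set C) N" "openin (top_of_set C) (C - N)"
    using N by (auto simp: clopen_in_def intro: openin_diff)
  \<comment> \<open>Intersecting with \<open>C\<close> keeps the second factor open in
    \<open>C\<close> when \<open>\<rho> x = 1\<close>, where the family is empty and its
    intersection is the whole type.\<close>
  define T where "T = {y \<in> C. H (int (\<rho> x)) y \<in> N} \<inter> (C \<inter> (\<Inter>j\<in>{1..<\<rho> x}. {y \<in> C. H (int j) y \<in> C - N}))"
  have "openin (top_of_set C) (C \<inter> (\<Inter>j\<in>{1..<\<rho> x}. {y \<in> C. H (int j) y \<in> C - N}))"
  proof (cases "{1..<\<rho> x} = {}")
    case False
    have "openin (top_of_set C) (\<Inter>j\<in>{1..<\<rho> x}. {y \<in> C. H (int j) y \<in> C - N})"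
      using False openin_H_vimage[OF op(2)] by (intro openin_INT2) auto
    then show ?thesis by (simp add: openin_Int)
  qed simp
  then have "openin (top_of_set C) T" unfolding T_def using openin_H_vimage[OF op(1)] by blast
  moreover have "x \<in> T" using x return_in no_earlier_return by (auto simp: T_def)
  moreover have "\<rho> y = \<rho> x" if "y \<in> T" for y
  proof (rule antisym)
    have y: "y \<in> C" "H (int (\<rho> x)) y \<in> N" "\<And>j. j \<ge> 1 \<Longrightarrow> j < \<rho> x \<Longrightarrow> H (int j) y \<notin> N"
      using that by (auto simp: T_def)
    show "\<rho> y \<le> \<rho> x"
      using no_earlier_return[of "int (\<rho> x)" y] y \<rho>_pos[OF x] by fastforce
    show "\<rho> x \<le> \<rho> y"
      using y(3)[of "\<rho> y"] return_in[OF y(1)] \<rho>_pos[OF y(1)] by fastforce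
  qed
  ultimately show ?thesis by blast
qed

lemma continuous_r: "continuous_on N r" and continuous_\<rho>: "continuous_on N (\<lambda>x. real (\<rho> x))"
proof -
  \<comment> \<open>Both maps have the form \<open>g (\<rho> x) x\<close> with every
    \<open>g k\<close> continuous, and the index \<open>\<rho> x\<close> is locally
    constant.\<close>
  have *: "continuous_on N f" if f: "\<And>k. continuous_on C (g k)" "\<And>x. f x = g (\<rho> x) x"
    for f :: "'a \<Rightarrow> 'c::topological_space" and g
    unfolding continuous_on_eq_continuous_within
  proof
    fix x assume x: "x \<in> N"
    obtain T where T: "openin (top_of_set C) T" "x \<in> T" "\<forall>y\<in>T. \<rho> y = \<rho> x"
      using \<rho>_locally_constant N_sub x by blast
    obtain W where W: "open W" "T = C \<inter> W" using T(1) unfolding openin_open by blast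
    then have "T \<inter> N = N \<inter> W" using N_sub by blast
    then have "openin (top_of_set N) (T \<inter> N)" using W(1) unfolding openin_open by blast
    moreover have "continuous (at x within N) (g (\<rho> x))"
    proof (rule continuous_within_subset)
      show "continuous (at x within C) (g (\<rho> x))"
        using f(1) N_sub[OF x] unfolding continuous_on_eq_continuous_within by blast
    qed (use N_sub in blast)
    moreover have "g (\<rho> x) y = f y" if "y \<in> T \<inter> N" for y
    proof -
      have "\<rho> y = \<rho> x" using T(3) that by blast
      then show ?thesis by (simp only: f(2))
    qed
    moreover have "x \<in> T \<inter> N" using T(2) x by blast
    ultimately show "continuous (at x within N) f"
      using continuous_transform_within_openin by blast
  qed
  show "continuous_on N r" by (rule *[of "\<lambda>k. H (int k)"]) (auto simp: continuous_H r_eq)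
  show "continuous_on N (\<lambda>x. real (\<rho> x))" by (rule *[of "\<lambda>k x. real k"]) auto
qed

lemma r_in: "x \<in> N \<Longrightarrow> r x \<in> N" using return_in N_sub by (simp add: r_eq)

lemma inj_r: "inj_on r N"
proof (rule inj_onI)
  \<comment> \<open>The point \<open>y\<close> with the longer return time passes through
    \<open>x\<close> at time \<open>\<rho> y - \<rho> x\<close>. If this is positive, it is a visit
    to \<open>N\<close> before the first return.\<close>
  have *: "x = y" if "x \<in> N" "y \<in> N" "r x = r y" "\<rho> x \<le> \<rho> y" for x y
  proof -
    have "x = H (- int (\<rho> x)) (H (int (\<rho> y)) y)" using that N_sub H_cancel(2)[of x "int (\<rho> x)"] by (simp add: r_eq)
    then have x: "x = H (int (\<rho> y) - int (\<rho> x)) y" using that N_sub H_add[of y "- int (\<rho> x)" "int (\<rho> y)"] by simp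
    have "\<rho> x \<ge> 1" using that N_sub \<rho>_pos by blast
    then have "\<rho> x = \<rho> y"
      using no_earlier_return[of "int (\<rho> y) - int (\<rho> x)" y] that x by fastforce
    then show ?thesis using x by simp
  qed
  fix x y assume "x \<in> N" "y \<in> N" "r x = r y"
  then show "x = y" using *[of x y] *[of y x] by (metis linear)
qed

lemma r_image: "r ` N = N"
proof
  show "r ` N \<subseteq> N" using r_in by blast
  show "N \<subseteq> r ` N"
  proof
    fix y assume y: "y \<in> N"
    \<comment> \<open>The preimage of \<open>y\<close> is its most recent earlier visit to
      \<open>N\<close>, hence the least backward time.\<close>
    define P where "P k \<longleftrightarrow> k \<ge> 1 \<and> H (- int k) y \<in> N" for k
    obtain k where "k \<ge> 1" "H (- k) y \<in> N" using backward_hit[OF N N_sub[OF y]] by blast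
    then have "P (nat k)" by (simp add: P_def)
    then have P: "P (LEAST k. P k)" by (rule LeastI)
    define m where "m = (LEAST k. P k)"
    define x where "x = H (- int m) y"
    have x: "x \<in> N" "m \<ge> 1" using P by (auto simp: P_def x_def m_def)
    have Hx: "H j x = H (j - int m) y" for j using H_add[OF N_sub[OF y], of j "- int m"] by (simp add: x_def)
    have "\<rho> x \<le> m" using no_earlier_return[of "int m" x] Hx[of "int m"] y x by fastforce
    moreover have "\<not> \<rho> x < m"
    proof
      assume lt: "\<rho> x < m"
      then have "H (- int (m - \<rho> x)) y \<in> N" using return_in[OF N_sub[OF x(1)]] Hx[of "int (\<rho> x)"] by (simp add: of_nat_diff)
      then have "P (m - \<rho> x)" using lt by (simp add: P_def)
      moreover have "m - \<rho> x < m" using \<rho>_pos[OF N_sub[OF x(1)]] lt by simp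
      ultimately show False using not_less_Least[of "m - \<rho> x" P] by (simp add: m_def)
    qed
    ultimately have "r x = y" using Hx[of "int m"] by (simp add: r_eq)
    then show "y \<in> r ` N" using x by blast
  qed
qed

text \<open>Everything shown for suspensions of homeomorphisms of compact sets now applies to the
  return map.\<close>

sublocale R: compact_homeo N r
proof
  show cN: "compact N" using N compact closedin_compact unfolding clopen_in_def by blast
  show "\<exists>g. homeomorphism N N r g"
    using homeomorphism_compact[OF cN continuous_r r_image inj_r] by blast
qed

text \<open>\<open>a n\<close> is the time of the \<open>n\<close>-th visit of the orbit of
  \<open>x\<close> to \<open>N\<close>, counted backwards for negative \<open>n\<close>; the gaps
  between visits are the return times.\<close>

lemma visits:
  assumes x: "x \<in> N"
  obtains a :: "int \<Rightarrow> int" where "\<And>n. a (n + 1) = a n + int (\<rho> (R.H n x))"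
    "\<And>n. R.H n x = H (a n) x"
proof -
  obtain a where a: "a 0 = 0" "\<And>n. a (n + 1) = a n + int (\<rho> (R.H n x))"
    using bi_infinite_partial_sums[of "\<lambda>n. int (\<rho> (R.H n x))"] by blast
  have "R.H n x = H (a n) x" for n
  proof (induction n rule: int_induct[of _ 0])
    case base
    show ?case by (simp add: a)
  next
    case (step1 i)
    then show ?case using R.H_succ[OF x, of i] H_add[OF N_sub[OF x], of "int (\<rho> (R.H i x))" "a i"]
      r_eq[of "R.H i x"] by (metis a(2) add.commute)
  next
    case (step2 i)
    have j: "R.H (i - 1) x \<in> C" using N_sub R.H_in x by blast
    have "R.H i x = H (int (\<rho> (R.H (i - 1) x))) (R.H (i - 1) x)"
      using R.H_succ[OF x, of "i - 1"] by (simp add: r_eq)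
    then have "R.H (i - 1) x = H (- int (\<rho> (R.H (i - 1) x))) (H (a i) x)"
      using H_cancel(2)[OF j, of "int (\<rho> (R.H (i - 1) x))"] step2 by simp
    then show ?case using H_add[OF N_sub[OF x], of "- int (\<rho> (R.H (i - 1) x))" "a i"] a(2)[of "i - 1"] by simp
  qed
  with a that show ?thesis by blast
qed

end

section \<open>Flow equivalences from return maps\<close>

lemma flow_equivalent_sym:
  fixes C' :: "'b::metric_space set" and C :: "'a::metric_space set"
  assumes "compact_homeo C h" and "cantor_minimal C' h'" and fe: "flow_equivalent C h C' h'"
  shows "flow_equivalent C' h' C h"
proof -
  interpret A: compact_homeo C h by fact
  interpret B: cantor_minimal C' h' by fact
  obtain F where F: "homeomorphic_map A.\<Sigma> B.\<Sigma> F"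
    and orb: "\<And>x. x \<in> topspace A.\<Sigma> \<Longrightarrow> F ` susp_orbit C h x = susp_orbit C' h' (F x)"
    and fl: "\<And>x. x \<in> topspace A.\<Sigma> \<Longrightarrow> \<exists>\<tau>::real \<Rightarrow> real. strict_mono \<tau>
                  \<and> (\<forall>s. F (susp_flow C h s x) = susp_flow C' h' (\<tau> s) (F x))"
    using fe unfolding flow_equivalent_def by blast
  obtain G where G: "homeomorphic_maps A.\<Sigma> B.\<Sigma> F G" using F homeomorphic_map_maps by blast
  have GF: "G (F x) = x" "F x \<in> topspace B.\<Sigma>" if "x \<in> topspace A.\<Sigma>" for x
    using G that unfolding homeomorphic_maps_def continuous_map_def by auto
  have FG: "F (G y) = y" "G y \<in> topspace A.\<Sigma>" if "y \<in> topspace B.\<Sigma>" for y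
    using G that unfolding homeomorphic_maps_def continuous_map_def by auto
  have flow_in: "susp_flow C h s x \<in> topspace A.\<Sigma>" if x: "x \<in> topspace A.\<Sigma>" for s x
  proof -
    obtain u v where "u \<in> C" "x = A.cov (u, v)" using A.cov_cases[OF x] .
    then show ?thesis by (simp only: A.flow_cov A.cov_in)
  qed
  have Gh: "homeomorphic_map B.\<Sigma> A.\<Sigma> G"
    using G homeomorphic_maps_sym homeomorphic_map_maps by blast
  show ?thesis unfolding flow_equivalent_def
  proof (intro exI[of _ G] conjI ballI)
    show "homeomorphic_map B.\<Sigma> A.\<Sigma> G" by fact
    fix y assume y: "y \<in> topspace B.\<Sigma>"
    define x where "x = G y"
    have x: "x \<in> topspace A.\<Sigma>" "F x = y" using FG[OF y] by (auto simp: x_def)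
    obtain \<tau> :: "real \<Rightarrow> real" where t: "strict_mono \<tau>" "\<And>s. F (susp_flow C h s x) = susp_flow C' h' (\<tau> s) y"
      using fl[OF x(1)] x(2) by auto
    have "G (F z) = z" if z: "z \<in> susp_orbit C h x" for z
    proof -
      obtain s where "z = susp_flow C h s x" using z unfolding susp_orbit_def by blast
      then show ?thesis by (simp only: GF(1) flow_in[OF x(1)])
    qed
    then have "(\<lambda>z. G (F z)) ` susp_orbit C h x = id ` susp_orbit C h x"
      by (intro image_cong) auto
    then have "G ` F ` susp_orbit C h x = susp_orbit C h x" unfolding image_image by simp
    then show "G ` susp_orbit C' h' y = susp_orbit C h (G y)"
      unfolding orb[OF x(1)] x(2) unfolding x_def .
    obtain b v where b: "b \<in> C'" "y = B.cov (b, v)" using B.cov_cases[OF y] .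
    \<comment> \<open>\<open>F\<close> maps the orbit onto the whole target orbit, and aperiodicity
      of the target turns equality of points into equality of times. So \<open>\<tau>\<close> is
      invertible, and its inverse is the time change for \<open>G\<close>.\<close>
    have "surj \<tau>" unfolding surj_def
    proof
      fix s
      have "susp_flow C' h' s y \<in> F ` susp_orbit C h x"
        using orb[OF x(1)] x(2) by (auto simp: susp_orbit_def)
      then obtain u where "susp_flow C' h' s y = susp_flow C' h' (\<tau> u) y"
        using t(2) by (auto simp: susp_orbit_def)
      then have "B.cov (b, v + s) = B.cov (b, v + \<tau> u)" unfolding b(2) B.flow_cov[OF b(1)] .
      then show "\<exists>u. s = \<tau> u" using B.cov_inj[OF b(1)] by fastforce
    qed
    then have inv: "\<tau> (inv \<tau> s) = s" for s by (rule surj_f_inv_f)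
    show "\<exists>\<tau>::real \<Rightarrow> real. strict_mono \<tau> \<and> (\<forall>s. G (susp_flow C' h' s y) = susp_flow C h (\<tau> s) (G y))"
    proof (intro exI[of _ "inv \<tau>"] conjI allI)
      show "strict_mono (inv \<tau>)"
      proof (rule strict_monoI)
        fix u v :: real assume "u < v"
        then have "\<tau> (inv \<tau> u) < \<tau> (inv \<tau> v)" by (simp only: inv)
        then show "inv \<tau> u < inv \<tau> v" by (simp only: strict_mono_less[OF t(1)])
      qed
      fix s
      show "G (susp_flow C' h' s y) = susp_flow C h (inv \<tau> s) (G y)"
      proof -
        have "F (susp_flow C h (inv \<tau> s) x) = susp_flow C' h' s y" by (simp only: t(2) inv)
        then show ?thesis
          unfolding x_def[symmetric] using GF(1)[OF flow_in[OF x(1)], of "inv \<tau> s"] by simp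
      qed
    qed
  qed
qed

lemma flow_equivalent_trans:
  assumes "flow_equivalent A f B g" and "flow_equivalent B g D k"
  shows "flow_equivalent A f D k"
proof -
  obtain F where F: "homeomorphic_map (susp_top A f) (susp_top B g) F"
    and Fo: "\<And>x. x \<in> topspace (susp_top A f) \<Longrightarrow> F ` susp_orbit A f x = susp_orbit B g (F x)"
    and Ft: "\<And>x. x \<in> topspace (susp_top A f) \<Longrightarrow> \<exists>\<tau>::real \<Rightarrow> real. strict_mono \<tau>
                  \<and> (\<forall>s. F (susp_flow A f s x) = susp_flow B g (\<tau> s) (F x))"
    using assms(1) unfolding flow_equivalent_def by blast
  obtain G where G: "homeomorphic_map (susp_top B g) (susp_top D k) G"
    and Go: "\<And>x. x \<in> topspace (susp_top B g) \<Longrightarrow> G ` susp_orbit B g x = susp_orbit D k (G x)"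
    and Gt: "\<And>x. x \<in> topspace (susp_top B g) \<Longrightarrow> \<exists>\<tau>::real \<Rightarrow> real. strict_mono \<tau>
                  \<and> (\<forall>s. G (susp_flow B g s x) = susp_flow D k (\<tau> s) (G x))"
    using assms(2) unfolding flow_equivalent_def by blast
  show ?thesis unfolding flow_equivalent_def
  proof (intro exI[of _ "G \<circ> F"] conjI ballI)
    show "homeomorphic_map (susp_top A f) (susp_top D k) (G \<circ> F)"
      using F G by (rule homeomorphic_map_compose)
    fix x assume x: "x \<in> topspace (susp_top A f)"
    then have Fx: "F x \<in> topspace (susp_top B g)"
      using F homeomorphic_imp_surjective_map by blast
    show "(G \<circ> F) ` susp_orbit A f x = susp_orbit D k ((G \<circ> F) x)"
      unfolding image_comp[symmetric] Fo[OF x] Go[OF Fx] by simp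
    obtain \<sigma> :: "real \<Rightarrow> real" where s: "strict_mono \<sigma>" "\<And>s. F (susp_flow A f s x) = susp_flow B g (\<sigma> s) (F x)"
      using Ft[OF x] by blast
    obtain \<tau> :: "real \<Rightarrow> real" where t: "strict_mono \<tau>" "\<And>s. G (susp_flow B g s (F x)) = susp_flow D k (\<tau> s) (G (F x))"
      using Gt[OF Fx] by blast
    show "\<exists>\<tau>::real \<Rightarrow> real. strict_mono \<tau> \<and> (\<forall>s. (G \<circ> F) (susp_flow A f s x) = susp_flow D k (\<tau> s) ((G \<circ> F) x))"
      by (rule exI[of _ "\<tau> \<circ> \<sigma>"]) (auto simp: s t strict_mono_o)
  qed
qed

text \<open>The conjugacy acts on the base and leaves heights alone, so it commutes with the flows
  and the time change is the identity.\<close>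

lemma flow_equivalent_conjugate:
  fixes C' :: "'b::metric_space set" and C :: "'a::metric_space set"
  assumes "compact_homeo C h" and "compact_homeo C' h'" and conj: "top_conjugate C h C' h'"
  shows "flow_equivalent C h C' h'"
proof -
  interpret A: compact_homeo C h by fact
  interpret B: compact_homeo C' h' by fact
  obtain \<phi> \<psi> where ph: "homeomorphism C C' \<phi> \<psi>" and c: "\<And>x. x \<in> C \<Longrightarrow> \<phi> (h x) = h' (\<phi> x)"
    using conj unfolding top_conjugate_def by blast
  have \<phi>: "\<phi> x \<in> C'" "\<psi> (\<phi> x) = x" if "x \<in> C" for x
    using ph that by (auto simp: homeomorphism_def)
  have im: "\<phi> ` C = C'" using ph by (auto simp: homeomorphism_def)
  have cH: "\<phi> (A.H n x) = B.H n (\<phi> x)" if x: "x \<in> C" for n x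
  proof (induction n rule: int_induct[of _ 0])
    case base
    show ?case by simp
  next
    case (step1 i)
    then show ?case using A.H_succ[OF x, of i] B.H_succ[OF \<phi>(1)[OF x], of i] c x by simp
  next
    case (step2 i)
    have "h' (\<phi> (A.H (i - 1) x)) = h' (B.H (i - 1) (\<phi> x))"
      using A.H_succ[OF x, of "i - 1"] B.H_succ[OF \<phi>(1)[OF x], of "i - 1"] step2 c[of "A.H (i - 1) x"] x by simp
    then show ?case using B.inv_h \<phi>(1) x by (metis A.H_in B.H_in)
  qed
  define F :: "'a \<times> real \<Rightarrow> 'b \<times> real" where "F p = (\<phi> (fst p), snd p)" for p
  have Fcov: "F (A.cov (x, s)) = B.cov (\<phi> x, s)" if "x \<in> C" for x s
    using cH that by (simp add: F_def A.cov_eq B.cov_eq)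
  have "homeomorphic_map A.\<Sigma> B.\<Sigma> F"
  proof (rule continuous_imp_homeomorphic_map)
    show "compact_space A.\<Sigma>" by (rule A.compact_susp)
    show "Hausdorff_space B.\<Sigma>" by (rule B.Hausdorff_susp)
    have "F ` (C \<times> {0..<1}) = \<phi> ` C \<times> {0..<1}" unfolding F_def by force
    then show "F ` topspace A.\<Sigma> = topspace B.\<Sigma>"
      unfolding A.topspace_susp B.topspace_susp im .
    show "inj_on F (topspace A.\<Sigma>)"
      by (rule inj_on_inverseI[where g = "\<lambda>q. (\<psi> (fst q), snd q)"])
         (use \<phi>(2) in \<open>auto simp: F_def A.topspace_susp\<close>)
    have "continuous_on C \<phi>" using ph by (rule homeomorphism_cont1)
    then have "continuous_on (C \<times> {0..1::real}) (\<lambda>p. \<phi> (fst p))"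
      by (rule continuous_on_compose2) (auto intro: continuous_intros)
    then have "continuous_on (C \<times> {0..1}) F"
      unfolding F_def by (intro continuous_on_Pair continuous_on_snd continuous_on_id)
    moreover have "F ` (C \<times> {0..1}) \<subseteq> C' \<times> {0..1}" using \<phi>(1) by (auto simp: F_def)
    ultimately have "continuous_map (top_of_set (C \<times> {0..1})) (top_of_set (C' \<times> {0..1})) F"
      by (simp add: image_subset_iff_funcset)
    then have "continuous_map (top_of_set (C \<times> {0..1})) B.\<Sigma> (B.cov \<circ> F)"
      using B.continuous_cov_unit by (rule continuous_map_compose)
    then have "continuous_map (top_of_set (C \<times> {0..1})) B.\<Sigma> (F \<circ> A.cov)"
    proof (rule continuous_map_eq)
      fix p :: "'a \<times> real" assume "p \<in> topspace (top_of_set (C \<times> {0..1}))"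
      then have "F (A.cov (fst p, snd p)) = B.cov (F p)" unfolding F_def[of p] by (intro Fcov) auto
      then show "(B.cov \<circ> F) p = (F \<circ> A.cov) p" by simp
    qed
    with A.quotient_cov_unit show "continuous_map A.\<Sigma> B.\<Sigma> F"
      by (rule continuous_compose_quotient_map)
  qed
  moreover have "F (susp_flow C h s p) = susp_flow C' h' s (F p)" if p: "p \<in> topspace A.\<Sigma>" for s p
  proof -
    obtain x t where x: "x \<in> C" "p = A.cov (x, t)" using A.cov_cases[OF p] .
    show ?thesis
      by (simp only: x(2) A.flow_cov[OF x(1)] Fcov[OF x(1)] B.flow_cov[OF \<phi>(1)[OF x(1)]])
  qed
  moreover from this have "F ` susp_orbit C h p = susp_orbit C' h' (F p)" if "p \<in> topspace A.\<Sigma>" for p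
    unfolding susp_orbit_def image_image using that by simp
  ultimately show ?thesis unfolding flow_equivalent_def
    by (intro exI[of _ F]) (auto intro!: exI[of _ "\<lambda>s. s"] strict_monoI)
qed

section \<open>The suspension of a return map\<close>

context return_system
begin

lemma flow_equivalent_return: "flow_equivalent N r C h"
proof -
  \<comment> \<open>The unit segment over \<open>x\<close> is stretched to the piece of flow line of
    length \<open>\<rho> x\<close> that leads from \<open>x\<close> to its return.\<close>
  define F where "F p = cov (fst p, snd p * \<rho> (fst p))" for p :: "'a \<times> real"
  \<comment> \<open>Along one flow line \<open>F\<close> is the linear interpolation of the visit
    times.\<close>
  have clock: "\<exists>A::real \<Rightarrow> real. strict_mono A \<and> surj A \<and> (\<forall>s. F (R.cov (x, s)) = cov (x, A s))"
    if x: "x \<in> N" for x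
  proof -
    obtain a :: "int \<Rightarrow> int" where a: "\<And>n. a (n + 1) = a n + int (\<rho> (R.H n x))" "\<And>n. R.H n x = H (a n) x"
      using visits[OF x] by blast
    have "a n < a (n + 1)" for n using a(1)[of n] \<rho>_pos[OF N_sub[OF R.H_in[OF x]], of n] by simp
    note A = interpolate_steps[of a, OF this, of "\<lambda>s. a \<lfloor>s\<rfloor> + frac s * (a (\<lfloor>s\<rfloor> + 1) - a \<lfloor>s\<rfloor>)", OF refl]
    have "F (R.cov (x, s)) = cov (x, a \<lfloor>s\<rfloor> + frac s * (a (\<lfloor>s\<rfloor> + 1) - a \<lfloor>s\<rfloor>))" for s
    proof -
      have "F (R.cov (x, s)) = cov (R.H \<lfloor>s\<rfloor> x, frac s * \<rho> (R.H \<lfloor>s\<rfloor> x))"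
        by (simp only: F_def R.cov_eq fst_conv snd_conv)
      also have "\<dots> = cov (x, frac s * \<rho> (R.H \<lfloor>s\<rfloor> x) + a \<lfloor>s\<rfloor>)"
        using a(2) cov_shift[OF N_sub[OF x]] by simp
      also have "frac s * \<rho> (R.H \<lfloor>s\<rfloor> x) + a \<lfloor>s\<rfloor> = a \<lfloor>s\<rfloor> + frac s * (a (\<lfloor>s\<rfloor> + 1) - a \<lfloor>s\<rfloor>)"
        by (simp only: a(1)) simp
      finally show ?thesis .
    qed
    with A show ?thesis by blast
  qed
  \<comment> \<open>If the images agree, \<open>y\<close> lies on the \<open>h\<close>-orbit of
    \<open>x\<close>. As \<open>y\<close> is in \<open>N\<close> and nothing in \<open>N\<close>
    lies between consecutive visits, \<open>y\<close> is an iterate of \<open>x\<close> under the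
    return map; then strict monotonicity of \<open>A\<close> compares the times.\<close>
  have inj: "p = q" if p: "p \<in> topspace R.\<Sigma>" and q: "q \<in> topspace R.\<Sigma>" and eq: "F p = F q" for p q
  proof -
    obtain x s where x: "x \<in> N" "p = R.cov (x, s)" using R.cov_cases[OF p] .
    obtain y t where y: "y \<in> N" "q = R.cov (y, t)" using R.cov_cases[OF q] .
    obtain A :: "real \<Rightarrow> real" where A: "strict_mono A" "\<And>s. F (R.cov (x, s)) = cov (x, A s)" using clock[OF x(1)] by blast
    obtain B :: "real \<Rightarrow> real" where B: "\<And>s. F (R.cov (y, s)) = cov (y, B s)" using clock[OF y(1)] by blast
    obtain m where m: "y = H m x"
      using eq unfolding x(2) y(2) A B using cov_eq_iff N_sub x(1) y(1) by blast
    obtain a :: "int \<Rightarrow> int" where a: "\<And>n. a (n + 1) = a n + int (\<rho> (R.H n x))" "\<And>n. R.H n x = H (a n) x"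
      using visits[OF x(1)] by blast
    have "a n < a (n + 1)" for n using a(1)[of n] \<rho>_pos[OF N_sub[OF R.H_in[OF x(1)]], of n] by simp
    then obtain n where n: "a n \<le> m" "m < a (n + 1)" using int_step_bracket[of a m] by blast
    have "H (m - a n) (R.H n x) = y" using a(2) m H_add[OF N_sub[OF x(1)], of "m - a n" "a n"] by simp
    then have "m = a n" using no_earlier_return[of "m - a n" "R.H n x"] n a(1)[of n] y(1) by fastforce
    then have yn: "y = R.H n x" using m a(2) by simp
    then have q': "q = R.cov (x, t + n)" using R.cov_shift[OF x(1)] y(2) by simp
    then have "cov (x, A s) = cov (x, A (t + n))" using eq x(2) A(2) by metis
    then have "A s = A (t + n)" using cov_inj N_sub x(1) by blast
    then show ?thesis using A(1) q' x(2) by (simp add: strict_mono_eq)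
  qed
  \<comment> \<open>Every orbit enters \<open>N\<close>, so each point can be written with a base
    point in \<open>N\<close>, where \<open>clock\<close> applies.\<close>
  have surj: "\<exists>p\<in>topspace R.\<Sigma>. F p = z" if z: "z \<in> topspace \<Sigma>" for z
  proof -
    obtain y t where y: "y \<in> C" "z = cov (y, t)" using cov_cases[OF z] .
    define x where "x = H (int (\<rho> y)) y"
    have x: "x \<in> N" using return_in[OF y(1)] by (simp add: x_def)
    obtain A :: "real \<Rightarrow> real" where A: "surj A" "\<And>s. F (R.cov (x, s)) = cov (x, A s)" using clock[OF x(1)] by blast
    have "z = cov (x, t - \<rho> y)" using cov_shift[OF y(1), of "int (\<rho> y)" "t - \<rho> y"] y(2) by (simp add: x_def)
    moreover obtain s where "t - \<rho> y = A s" using A(1) by (metis surjD)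
    ultimately show ?thesis using A(2)[of s] R.cov_in[OF x] by metis
  qed
  have F_in: "F p \<in> topspace \<Sigma>" if "p \<in> topspace R.\<Sigma>" for p
    using that N_sub unfolding R.topspace_susp F_def by auto
  have "homeomorphic_map R.\<Sigma> \<Sigma> F"
  proof (rule continuous_imp_homeomorphic_map)
    show "compact_space R.\<Sigma>" by (rule R.compact_susp)
    show "Hausdorff_space \<Sigma>" by (rule Hausdorff_susp)
    show "F ` topspace R.\<Sigma> = topspace \<Sigma>" using F_in surj by blast
    show "inj_on F (topspace R.\<Sigma>)" using inj by (rule inj_onI)
    let ?f = "\<lambda>p. (fst p, snd p * real (\<rho> (fst p)))"
    have "continuous_on (N \<times> {0..1}) ?f"
      by (intro continuous_intros continuous_on_compose2[OF continuous_\<rho>]) auto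
    then have "continuous_map (top_of_set (N \<times> {0..1})) (top_of_set (C \<times> UNIV)) ?f"
      using N_sub by auto
    then have "continuous_map (top_of_set (N \<times> {0..1})) \<Sigma> (cov \<circ> ?f)"
      using continuous_cov by (rule continuous_map_compose)
    \<comment> \<open>Only the top \<open>s = 1\<close> needs care: \<open>R.cov\<close> takes it to
      \<open>(r x, 0)\<close>, while the stretched segment ends at height \<open>\<rho> x\<close>
      over \<open>x\<close>. These are lifts of the same point.\<close>
    moreover have "(cov \<circ> ?f) p = (F \<circ> R.cov) p" if p: "p \<in> N \<times> {0..1}" for p
    proof -
      obtain x s where x: "p = (x, s)" "x \<in> N" "0 \<le> s" "s \<le> 1" using p by auto
      show ?thesis
      proof (cases "s = 1")
        case True
        then show ?thesis
          using x cov_shift[OF N_sub[OF x(2)], of "int (\<rho> x)" 0] R.H_1[OF x(2)] r_eq[of x]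
          by (simp add: F_def R.cov_eq)
      next
        case False
        then show ?thesis using x R.cov_fundamental[OF x(2,3)] by (simp add: F_def)
      qed
    qed
    ultimately have "continuous_map (top_of_set (N \<times> {0..1})) \<Sigma> (F \<circ> R.cov)"
      by (rule continuous_map_eq) simp
    with R.quotient_cov_unit show "continuous_map R.\<Sigma> \<Sigma> F"
      by (rule continuous_compose_quotient_map)
  qed
  moreover have "F ` susp_orbit N r p = susp_orbit C h (F p)
            \<and> (\<exists>\<tau>::real \<Rightarrow> real. strict_mono \<tau> \<and> (\<forall>s. F (susp_flow N r s p) = susp_flow C h (\<tau> s) (F p)))"
    if p: "p \<in> topspace R.\<Sigma>" for p
  proof -
    obtain x t where x: "x \<in> N" "p = R.cov (x, t)" using R.cov_cases[OF p] .
    obtain A :: "real \<Rightarrow> real" where A: "strict_mono A" "surj A" "\<And>s. F (R.cov (x, s)) = cov (x, A s)"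
      using clock[OF x(1)] by blast
    define \<tau> where "\<tau> s = A (t + s) - A t" for s
    have fl: "F (susp_flow N r s p) = susp_flow C h (\<tau> s) (F p)" for s
      unfolding x(2) A(3) R.flow_cov[OF x(1)] flow_cov[OF N_sub[OF x(1)]] \<tau>_def by simp
    have "strict_mono \<tau>" using A(1) by (auto simp: strict_mono_def \<tau>_def)
    moreover have "surj \<tau>" unfolding surj_def
    proof
      fix u
      obtain v where "u + A t = A v" using A(2) by (metis surjD)
      then show "\<exists>s. u = \<tau> s" by (intro exI[of _ "v - t"]) (simp add: \<tau>_def algebra_simps)
    qed
    moreover have "F ` susp_orbit N r p = (\<lambda>s. susp_flow C h s (F p)) ` range \<tau>"
      unfolding susp_orbit_def image_image fl ..
    ultimately show ?thesis using fl unfolding susp_orbit_def by metis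
  qed
  ultimately show ?thesis unfolding flow_equivalent_def by blast
qed

end

section \<open>Return maps from flow equivalences\<close>

locale flow_equivalence = A: cantor_minimal C h + B: cantor_minimal C' h'
  for C :: "'a::metric_space set" and h and C' :: "'b::metric_space set" and h' +
  fixes G :: "'a \<times> real \<Rightarrow> 'b \<times> real"
  assumes homeo_G: "homeomorphic_map A.\<Sigma> B.\<Sigma> G"
    and orbit_G: "\<And>p. p \<in> topspace A.\<Sigma> \<Longrightarrow> G ` susp_orbit C h p = susp_orbit C' h' (G p)"
    and flow_G: "\<And>p. p \<in> topspace A.\<Sigma> \<Longrightarrow> \<exists>\<tau>::real \<Rightarrow> real. strict_mono \<tau>
                  \<and> (\<forall>s. G (susp_flow C h s p) = susp_flow C' h' (\<tau> s) (G p))"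
begin

lemma G_inj: assumes "x \<in> C" "w \<in> C" "G (A.cov (x, s)) = G (A.cov (w, t))"
  shows "\<exists>m. w = A.H m x \<and> s = t + of_int m"
proof -
  have "inj_on G (topspace A.\<Sigma>)" using homeo_G by (rule homeomorphic_imp_injective_map)
  then have "A.cov (x, s) = A.cov (w, t)" using assms A.cov_in by (meson inj_onD)
  then show ?thesis using A.cov_eq_iff assms by blast
qed

text \<open>Recentring the time change of \<open>flow_G\<close> at a chosen pair of lifts gives one
  increasing bijection for the entire flow line. Aperiodicity of the target forces it to send
  \<open>s0\<close> to \<open>t0\<close>, and it is onto because \<open>G\<close> maps orbits onto
  orbits.\<close>

lemma clock:
  assumes x: "x \<in> C" and y: "y \<in> C'" and eq: "G (A.cov (x, s0)) = B.cov (y, t0)"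
  obtains a :: "real \<Rightarrow> real" where "strict_mono a" "surj a" "a s0 = t0" "\<And>s. G (A.cov (x, s)) = B.cov (y, a s)"
proof -
  let ?p = "A.cov (x, s0)"
  have p: "?p \<in> topspace A.\<Sigma>" using x by simp
  obtain \<tau> :: "real \<Rightarrow> real" where t: "strict_mono \<tau>" "\<And>s. G (susp_flow C h s ?p) = susp_flow C' h' (\<tau> s) (G ?p)"
    using flow_G[OF p] by blast
  define a where "a s = t0 + \<tau> (s - s0)" for s
  have Ga: "G (A.cov (x, s)) = B.cov (y, a s)" for s
    using t(2)[of "s - s0"] unfolding eq A.flow_cov[OF x] B.flow_cov[OF y] a_def by simp
  moreover have as0: "a s0 = t0" using Ga[of s0] B.cov_inj[OF y] unfolding eq by metis
  moreover have "strict_mono a" using t(1) by (auto simp: a_def strict_mono_def)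
  moreover have "surj a" unfolding surj_def
  proof
    fix u
    have "susp_flow C' h' (u - t0) (G ?p) \<in> G ` susp_orbit C h ?p"
      unfolding orbit_G[OF p] by (auto simp: susp_orbit_def)
    then obtain s where "susp_flow C' h' (u - t0) (G ?p) = G (susp_flow C h s ?p)"
      unfolding susp_orbit_def by blast
    then have "B.cov (y, u) = B.cov (y, a (s0 + s))"
      unfolding A.flow_cov[OF x] Ga B.flow_cov[OF y] as0 by simp
    then show "\<exists>s. u = a s" using B.cov_inj[OF y] by blast
  qed
  ultimately show ?thesis using that by blast
qed

lemma openin_cov_preimage:
  assumes "openin (top_of_set (C' \<times> UNIV)) O'"
  shows "openin (top_of_set (C \<times> UNIV)) {p \<in> C \<times> UNIV. G (A.cov p) \<in> B.cov ` O'}"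
proof -
  have "continuous_map (top_of_set (C \<times> UNIV)) B.\<Sigma> (G \<circ> A.cov)"
    using A.continuous_cov homeomorphic_imp_continuous_map[OF homeo_G] by (rule continuous_map_compose)
  then have "openin (top_of_set (C \<times> UNIV)) {p \<in> topspace (top_of_set (C \<times> UNIV)). (G \<circ> A.cov) p \<in> B.cov ` O'}"
    using B.open_cov[OF assms] by (rule openin_continuous_map_preimage)
  then show ?thesis by simp
qed

text \<open>Lifts of one point differ in height by an integer, while heights in this open slab
  differ by less than 1.\<close>

lemma inj_on_cov_thin: "inj_on B.cov (C' \<times> {-1/2<..<1/2})"
proof (rule inj_onI)
  fix p q assume p: "p \<in> C' \<times> {-1/2<..<1/2::real}" and q: "q \<in> C' \<times> {-1/2<..<1/2::real}" and eq: "B.cov p = B.cov q"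
  have C: "fst p \<in> C'" "fst q \<in> C'" using p q by auto
  obtain n where n: "fst q = B.H n (fst p)" "snd p = snd q + of_int n"
    using eq B.cov_eq_iff[OF C, of "snd p" "snd q"] by auto
  have "\<bar>real_of_int n\<bar> < 1" using n(2) p q by auto
  then have "n = 0" by linarith
  then show "p = q" using n by (simp add: prod_eq_iff)
qed

text \<open>The covering is injective over the slab \<open>C' \<times> (-1/2, 1/2)\<close>, so \<open>G\<close> lifts to a map \<open>Q\<close> into the
  slab, defined on the open set \<open>W\<close> of points that \<open>G\<close> sends there.\<close>

lemma lift_thin:
  obtains W Q where "openin (top_of_set (C \<times> UNIV)) W" "continuous_on W Q"
    "\<And>p. p \<in> W \<Longrightarrow> Q p \<in> C' \<times> {-1/2<..<1/2}" "\<And>p. p \<in> W \<Longrightarrow> B.cov (Q p) = G (A.cov p)"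
    "\<And>p q. p \<in> C \<times> UNIV \<Longrightarrow> q \<in> C' \<times> {-1/2<..<1/2} \<Longrightarrow> G (A.cov p) = B.cov q \<Longrightarrow> p \<in> W \<and> Q p = q"
proof -
  define B' where "B' = C' \<times> {-1/2<..<1/2::real}"
  define W where "W = {p \<in> C \<times> UNIV. G (A.cov p) \<in> B.cov ` B'}"
  define Q where "Q p = inv_into B' B.cov (G (A.cov p))" for p
  have opB: "openin (top_of_set (C' \<times> UNIV)) B'" unfolding B'_def by (intro openin_Times) auto
  have opW: "openin (top_of_set (C \<times> UNIV)) W" unfolding W_def using openin_cov_preimage[OF opB] .
  have Q: "Q p \<in> B'" "B.cov (Q p) = G (A.cov p)" if "p \<in> W" for p
    using that unfolding W_def Q_def by (auto intro: inv_into_into f_inv_into_f)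
  have Q': "p \<in> W \<and> Q p = q" if "p \<in> C \<times> UNIV" "q \<in> B'" "G (A.cov p) = B.cov q" for p q
  proof -
    have "p \<in> W" using that unfolding W_def by blast
    moreover have "Q p = q"
      unfolding Q_def that(3) using inj_on_cov_thin that(2) unfolding B'_def by (rule inv_into_f_f)
    ultimately show ?thesis ..
  qed
  have "continuous_on W Q"
  proof (rule continuous_on_open_gen[THEN iffD2])
    show "Q \<in> W \<rightarrow> B'" using Q by blast
    show "\<forall>U. openin (top_of_set B') U \<longrightarrow> openin (top_of_set W) (W \<inter> Q -` U)"
    proof (intro allI impI)
      fix U assume U: "openin (top_of_set B') U"
      then have "openin (top_of_set (C' \<times> UNIV)) U" using opB openin_trans by blast
      then have "openin (top_of_set (C \<times> UNIV)) {p \<in> C \<times> UNIV. G (A.cov p) \<in> B.cov ` U}"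
        by (rule openin_cov_preimage)
      moreover have "{p \<in> C \<times> UNIV. G (A.cov p) \<in> B.cov ` U} = W \<inter> Q -` U"
      proof (intro subset_antisym subsetI)
        fix p assume p: "p \<in> {p \<in> C \<times> UNIV. G (A.cov p) \<in> B.cov ` U}"
        then obtain q where q: "q \<in> U" "G (A.cov p) = B.cov q" by blast
        then have "q \<in> B'" using U openin_imp_subset by blast
        then have "p \<in> W \<and> Q p = q" using Q' p q(2) by blast
        then show "p \<in> W \<inter> Q -` U" using q(1) by blast
      next
        fix p assume "p \<in> W \<inter> Q -` U"
        then have p: "p \<in> W" "Q p \<in> U" by auto
        then have "G (A.cov p) \<in> B.cov ` U" using Q(2)[OF p(1)] by (metis imageI)
        then show "p \<in> {p \<in> C \<times> UNIV. G (A.cov p) \<in> B.cov ` U}" using p(1) unfolding W_def by blast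
      qed
      ultimately have "openin (top_of_set (C \<times> UNIV)) (W \<inter> Q -` U)" by (simp only:)
      then show "openin (top_of_set W) (W \<inter> Q -` U)"
        by (rule openin_subset_trans) (use openin_imp_subset[OF opW] in auto)
    qed
  qed
  then show ?thesis using that[of W Q] opW Q Q' unfolding B'_def by blast
qed

text \<open>\<open>\<sigma> x\<close> is the height at which the flow line over \<open>x\<close>
  meets the section that \<open>G\<close> carries into \<open>C' \<times> {0}\<close>, and
  \<open>\<psi> x\<close> is where it lands. The bound on \<open>\<sigma>\<close> makes
  \<open>\<psi>\<close> injective and compatible with the order of visits in
  \<open>conjugate_return_maps\<close>.\<close>

lemma transversal:
  assumes K: "clopen_in C K" and y: "y \<in> C'"
  obtains U \<psi> and \<sigma> :: "'a \<Rightarrow> real" where "clopen_in C U" "U \<subseteq> K" "continuous_on U \<psi>" "y \<in> \<psi> ` U"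
    "clopen_in C' (\<psi> ` U)" "\<And>x. x \<in> U \<Longrightarrow> G (A.cov (x, \<sigma> x)) = B.cov (\<psi> x, 0)"
    "\<And>x w. x \<in> U \<Longrightarrow> w \<in> U \<Longrightarrow> \<bar>\<sigma> x - \<sigma> w\<bar> < 1"
proof -
  obtain W Q where opW: "openin (top_of_set (C \<times> UNIV)) W" and cQ: "continuous_on W Q"
    and Q: "\<And>p. p \<in> W \<Longrightarrow> Q p \<in> C' \<times> {-1/2<..<1/2}" "\<And>p. p \<in> W \<Longrightarrow> B.cov (Q p) = G (A.cov p)"
    and Q': "\<And>p q. p \<in> C \<times> UNIV \<Longrightarrow> q \<in> C' \<times> {-1/2<..<1/2} \<Longrightarrow> G (A.cov p) = B.cov q \<Longrightarrow> p \<in> W \<and> Q p = q"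
    using lift_thin by blast
  have "B.cov (y, 0) \<in> G ` topspace A.\<Sigma>"
    using y homeomorphic_imp_surjective_map[OF homeo_G] by simp
  then obtain p where p: "p \<in> topspace A.\<Sigma>" "G p = B.cov (y, 0)" by auto
  obtain x1 s1 where x1: "x1 \<in> C" "p = A.cov (x1, s1)" using A.cov_cases[OF p(1)] .
  \<comment> \<open>Recurrence moves the base point of the lift into \<open>K\<close>; lowering the
    height by \<open>k\<close> keeps the point of the suspension.\<close>
  obtain k where k: "(h ^^ k) x1 \<in> K" using A.forward_hit[OF K x1(1)] by blast
  define x0 where "x0 = A.H (int k) x1"
  define t where "t = s1 - int k"
  have x0: "x0 \<in> K" "x0 \<in> C" using k x1(1) by (simp_all add: x0_def A.H_of_nat A.funpow_in)
  have "A.cov (x0, t) = p" using A.cov_shift[OF x1(1), of "int k" t] x1(2) by (simp add: x0_def t_def)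
  then have Gx0: "G (A.cov (x0, t)) = B.cov (y, 0)" using p(2) by simp
  have x0W: "(x0, t) \<in> W \<and> Q (x0, t) = (y, 0)" using Q'[OF _ _ Gx0] x0 y by simp
  obtain W' where W': "open W'" "W = (C \<times> UNIV) \<inter> W'" using opW unfolding openin_open by blast
  then obtain A0 B0 where AB: "open A0" "open B0" "(x0, t) \<in> A0 \<times> B0" "A0 \<times> B0 \<subseteq> W'"
    using open_prod_elim[of W' "(x0, t)"] x0W by blast
  then obtain e where e: "e > 0" "cball t e \<subseteq> B0" using open_contains_cball by blast
  \<comment> \<open>The radius \<open>e\<close> keeps the box inside \<open>W\<close>; the cap 1/4
    makes values of \<open>\<sigma>\<close> differ by less than 1/2.\<close>
  define \<eta> where "\<eta> = min e (1/4)"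
  have \<eta>: "\<eta> > 0" "\<eta> \<le> 1/4" using e by (auto simp: \<eta>_def)
  define I where "I = {t - \<eta>..t + \<eta>}"
  define CA where "CA = C \<inter> A0"
  have inW: "(x, s) \<in> W" if "x \<in> CA" "s \<in> I" for x s
  proof -
    have "s \<in> cball t e" using that(2) by (auto simp: I_def \<eta>_def dist_real_def)
    then show ?thesis using that(1) e(2) AB(4) unfolding W'(2) CA_def by blast
  qed
  have tI: "t \<in> I" "t - \<eta> \<in> I" "t + \<eta> \<in> I" using \<eta> by (auto simp: I_def)
  define \<psi> where "\<psi> x = fst (Q (x, t))" for x
  define \<beta> where "\<beta> x s = snd (Q (x, s))" for x s
  have \<psi>C: "\<psi> x \<in> C'" if "x \<in> CA" for x
    using Q(1)[OF inW[OF that tI(1)]] by (auto simp: \<psi>_def mem_Times_iff)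
  have cI: "continuous_on I (\<lambda>s. Q (x, s))" if "x \<in> CA" for x
    by (rule continuous_on_compose2[OF cQ]) (auto intro!: continuous_intros inW that)
  have cC: "continuous_on CA (\<lambda>x. Q (x, s))" if "s \<in> I" for s
    by (rule continuous_on_compose2[OF cQ]) (auto intro!: continuous_intros inW that)
  \<comment> \<open>Along a vertical segment the base coordinate of \<open>Q\<close> traces a
    connected subset of a totally disconnected set, so it does not move.\<close>
  have const: "fst (Q (x, s)) = \<psi> x" if x: "x \<in> CA" and s: "s \<in> I" for x s
  proof -
    let ?S = "(\<lambda>s. fst (Q (x, s))) ` I"
    have "connected ?S"
      by (intro connected_continuous_image continuous_on_fst cI x) (simp add: I_def)
    moreover have "?S \<subseteq> C'" using Q(1)[OF inW[OF x]] by (auto simp: mem_Times_iff)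
    moreover have "\<psi> x \<in> ?S" using tI(1) by (auto simp: \<psi>_def)
    ultimately have "?S \<subseteq> connected_component_set C' (\<psi> x)" by (intro connected_component_maximal)
    also have "\<dots> = {\<psi> x}" using B.cantor \<psi>C[OF x] by (simp add: cantor_set_def)
    finally show ?thesis using s by blast
  qed
  have Q_eq: "Q (x, s) = (\<psi> x, \<beta> x s)" if "x \<in> CA" "s \<in> I" for x s
    using const[OF that] by (simp add: \<beta>_def prod_eq_iff)
  have G_eq: "G (A.cov (x, s)) = B.cov (\<psi> x, \<beta> x s)" if "x \<in> CA" "s \<in> I" for x s
    using Q(2)[OF inW[OF that]] Q_eq[OF that] by simp
  \<comment> \<open>On \<open>I\<close> the height of the lift coincides with the time change of the
    flow line, by injectivity of flow lines.\<close>
  have mono: "\<beta> x s < \<beta> x s'" if x: "x \<in> CA" and s: "s \<in> I" "s' \<in> I" "s < s'" for x s s'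
  proof -
    have xC: "x \<in> C" using x by (simp add: CA_def)
    obtain a :: "real \<Rightarrow> real" where a: "strict_mono a" "\<And>s. G (A.cov (x, s)) = B.cov (\<psi> x, a s)"
      by (rule clock[OF xC \<psi>C[OF x] G_eq[OF x tI(1)]]) (rule that; assumption)
    have "\<beta> x s = a s" if "s \<in> I" for s
      using G_eq[OF x that] a(2)[of s] B.cov_inj[OF \<psi>C[OF x]] by metis
    then show ?thesis using a(1) s by (simp add: strict_mono_less)
  qed
  have x0A: "x0 \<in> CA" using x0 AB(3) by (simp add: CA_def)
  have y0: "\<psi> x0 = y" "\<beta> x0 t = 0" using x0W by (simp_all add: \<psi>_def \<beta>_def)
  \<comment> \<open>Over \<open>L\<close> the lifted height is negative at the bottom of the box and
    positive at the top. This open condition prepares the intermediate value theorem and holds at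
    \<open>x0\<close>.\<close>
  define L where "L = CA \<inter> (\<lambda>x. \<beta> x (t - \<eta>)) -` {..<0} \<inter> (CA \<inter> (\<lambda>x. \<beta> x (t + \<eta>)) -` {0<..})"
  have opCA: "openin (top_of_set C) CA" using AB(1) unfolding CA_def openin_open by blast
  have "openin (top_of_set CA) (CA \<inter> (\<lambda>x. \<beta> x (t - \<eta>)) -` {..<0})"
       "openin (top_of_set CA) (CA \<inter> (\<lambda>x. \<beta> x (t + \<eta>)) -` {0<..})"
    unfolding \<beta>_def using cC[OF tI(2)] cC[OF tI(3)]
    by (auto intro!: continuous_openin_preimage_gen continuous_on_snd)
  then have "openin (top_of_set C) L" unfolding L_def using opCA openin_trans by blast
  moreover have "openin (top_of_set C) K" using K by (simp add: clopen_in_def)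
  ultimately have "openin (top_of_set C) (L \<inter> K)" by (rule openin_Int)
  moreover have "x0 \<in> L \<inter> K"
    using x0 x0A y0 \<eta> mono[OF x0A tI(2) tI(1)] mono[OF x0A tI(1) tI(3)] by (simp add: L_def)
  ultimately obtain U where U: "clopen_in C U" "x0 \<in> U" "U \<subseteq> L \<inter> K" using A.clopen_basis by metis
  have UA: "x \<in> CA" if "x \<in> U" for x using U(3) that unfolding L_def by blast
  have "\<exists>s. t - \<eta> < s \<and> s < t + \<eta> \<and> \<beta> x s = 0" if x: "x \<in> U" for x
  proof -
    have b: "\<beta> x (t - \<eta>) < 0" "0 < \<beta> x (t + \<eta>)" using U(3) x unfolding L_def by auto
    have "continuous_on I (\<beta> x)" unfolding \<beta>_def using cI[OF UA[OF x]] by (rule continuous_on_snd)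
    then obtain s where s: "t - \<eta> \<le> s" "s \<le> t + \<eta>" "\<beta> x s = 0"
      using IVT'[of "\<beta> x" "t - \<eta>" 0 "t + \<eta>"] b \<eta> unfolding I_def by auto
    moreover have "s \<noteq> t - \<eta>" "s \<noteq> t + \<eta>" using s(3) b by auto
    ultimately show ?thesis by (intro exI[of _ s]) auto
  qed
  then obtain \<sigma> where \<sigma>: "\<And>x. x \<in> U \<Longrightarrow> t - \<eta> < \<sigma> x \<and> \<sigma> x < t + \<eta> \<and> \<beta> x (\<sigma> x) = 0"
    by metis
  have \<sigma>I: "\<sigma> x \<in> I" if "x \<in> U" for x using \<sigma>[OF that] by (auto simp: I_def)
  have G\<sigma>: "G (A.cov (x, \<sigma> x)) = B.cov (\<psi> x, 0)" if "x \<in> U" for x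
    using G_eq[OF UA[OF that] \<sigma>I[OF that]] \<sigma>[OF that] by simp
  have c\<psi>: "continuous_on U \<psi>"
    unfolding \<psi>_def using cC[OF tI(1)] UA by (intro continuous_on_fst continuous_on_subset[OF cC[OF tI(1)]]) auto
  define E where "E = G ` A.cov ` (U \<times> {t - \<eta><..<t + \<eta>})"
  have "openin (top_of_set (C \<times> UNIV)) (U \<times> {t - \<eta><..<t + \<eta>})"
    using U(1) by (intro openin_Times) (auto simp: clopen_in_def)
  then have "openin B.\<Sigma> E" unfolding E_def
    using A.open_cov homeomorphic_imp_open_map[OF homeo_G] unfolding open_map_def by blast
  moreover have "continuous_map (top_of_set C') B.\<Sigma> (B.cov \<circ> (\<lambda>z. (z, 0)))"
  proof (rule continuous_map_compose[OF _ B.continuous_cov])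
    show "continuous_map (top_of_set C') (top_of_set (C' \<times> UNIV)) (\<lambda>z. (z, 0))"
      by (auto intro!: continuous_intros)
  qed
  ultimately have "openin (top_of_set C') {z \<in> topspace (top_of_set C'). (B.cov \<circ> (\<lambda>z. (z, 0))) z \<in> E}"
    using openin_continuous_map_preimage by blast
  moreover have "{z \<in> topspace (top_of_set C'). (B.cov \<circ> (\<lambda>z. (z, 0))) z \<in> E} = \<psi> ` U"
  proof (intro subset_antisym subsetI)
    fix z assume "z \<in> {z \<in> topspace (top_of_set C'). (B.cov \<circ> (\<lambda>z. (z, 0))) z \<in> E}"
    then have z: "z \<in> C'" "B.cov (z, 0) \<in> E" by auto
    then obtain x s where x: "x \<in> U" "s \<in> {t - \<eta><..<t + \<eta>}" "G (A.cov (x, s)) = B.cov (z, 0)"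
      unfolding E_def by auto
    have "s \<in> I" using x(2) by (auto simp: I_def)
    then have "Q (x, s) = (z, 0)"
      using Q'[OF _ _ x(3)] UA[OF x(1)] z(1) by (simp add: CA_def)
    then have "\<psi> x = z" using Q_eq[OF UA[OF x(1)] \<open>s \<in> I\<close>] by simp
    then show "z \<in> \<psi> ` U" using x(1) by blast
  next
    fix z assume "z \<in> \<psi> ` U"
    then obtain x where x: "x \<in> U" "z = \<psi> x" by blast
    have "B.cov (z, 0) \<in> E" unfolding x(2) G\<sigma>[OF x(1), symmetric] E_def
      using x(1) \<sigma>[OF x(1)] by (intro imageI) auto
    then show "z \<in> {z \<in> topspace (top_of_set C'). (B.cov \<circ> (\<lambda>z. (z, 0))) z \<in> E}"
      using \<psi>C[OF UA[OF x(1)]] x(2) by simp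
  qed
  ultimately have op: "openin (top_of_set C') (\<psi> ` U)" by (simp only:)
  have "compact U" using U(1) A.compact closedin_compact unfolding clopen_in_def by blast
  then have "closed (\<psi> ` U)" using c\<psi> compact_continuous_image compact_imp_closed by blast
  moreover have sub: "\<psi> ` U \<subseteq> C'" using \<psi>C UA by blast
  ultimately have "closedin (top_of_set C') (\<psi> ` U)" by (intro closed_subset)
  then have clV: "clopen_in C' (\<psi> ` U)" using op sub U(2) unfolding clopen_in_def by blast
  have near: "\<bar>\<sigma> x - \<sigma> w\<bar> < 1" if "x \<in> U" "w \<in> U" for x w
    using \<sigma>[OF that(1)] \<sigma>[OF that(2)] \<eta> by linarith
  show ?thesis
  proof (rule that[of U \<psi> \<sigma>])
    show "clopen_in C U" by fact
    show "U \<subseteq> K" using U(3) by blast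
    show "y \<in> \<psi> ` U" using y0 U(2) by blast
  qed (use c\<psi> clV G\<sigma> near in auto)
qed

text \<open>\<open>N\<close> is the preimage of \<open>N'\<close> under \<open>\<psi>\<close>. The
  flow equivalence matches visits of \<open>x\<close> to \<open>N\<close> with visits of
  \<open>\<psi> x\<close> to \<open>N'\<close> in the same order, so first returns match, and
  \<open>\<psi>\<close> is the conjugacy.\<close>

lemma conjugate_return_maps:
  fixes \<sigma> :: "'a \<Rightarrow> real"
  assumes U: "clopen_in C U" and c\<psi>: "continuous_on U \<psi>" and V: "clopen_in C' (\<psi> ` U)"
    and G\<sigma>: "\<And>x. x \<in> U \<Longrightarrow> G (A.cov (x, \<sigma> x)) = B.cov (\<psi> x, 0)"
    and near: "\<And>x w. x \<in> U \<Longrightarrow> w \<in> U \<Longrightarrow> \<bar>\<sigma> x - \<sigma> w\<bar> < 1"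
    and N': "clopen_in C' N'" "N' \<subseteq> \<psi> ` U"
  shows "\<exists>N. clopen_in C N \<and> N \<subseteq> U \<and> top_conjugate N (return_map h N) N' (return_map h' N')"
proof -
  define N where "N = U \<inter> \<psi> -` N'"
  have UC: "U \<subseteq> C" "openin (top_of_set C) U" "closedin (top_of_set C) U" and VC: "\<psi> ` U \<subseteq> C'"
    using U V by (auto simp: clopen_in_def)
  have inC: "x \<in> C" "x \<in> U" "\<psi> x \<in> N'" "\<psi> x \<in> C'" if "x \<in> N" for x
    using that UC VC by (auto simp: N_def)
  have "openin (top_of_set U) N" unfolding N_def
    using c\<psi> N' VC by (intro continuous_openin_preimage[where T = C']) (auto simp: clopen_in_def)
  moreover have "closedin (top_of_set U) N" unfolding N_def
    using c\<psi> N' VC by (intro continuous_closedin_preimage_gen[where T = C']) (auto simp: clopen_in_def)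
  moreover have im: "\<psi> ` N = N'" using N'(2) by (auto simp: N_def)
  moreover have "N \<noteq> {}" using N'(1) unfolding clopen_in_def im[symmetric] by blast
  ultimately have clN: "clopen_in C N"
    using openin_trans[OF _ UC(2)] closedin_trans[OF _ UC(3)] inC(1) unfolding clopen_in_def by blast
  interpret RA: return_system C h N by unfold_locales (rule clN)
  interpret RB: return_system C' h' N' by unfold_locales (rule N'(1))
  \<comment> \<open>Points with the same image are deck translates after lifting to heights
    \<open>\<sigma>\<close>; these heights differ by an integer of absolute value less than
    1.\<close>
  have inj: "inj_on \<psi> N"
  proof (rule inj_onI)
    fix x w assume xw: "x \<in> N" "w \<in> N" "\<psi> x = \<psi> w"
    have "G (A.cov (x, \<sigma> x)) = G (A.cov (w, \<sigma> w))" using G\<sigma> inC(2) xw by simp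
    then obtain m where m: "w = A.H m x" "\<sigma> x = \<sigma> w + of_int m"
      using G_inj inC(1) xw by blast
    have "\<bar>real_of_int m\<bar> < 1" using m(2) near[OF inC(2) inC(2)] xw(1,2) by fastforce
    then have "m = 0" by linarith
    then show "x = w" using m by simp
  qed
  have "continuous_on N \<psi>" using c\<psi> by (rule continuous_on_subset) (auto simp: N_def)
  then obtain \<phi> where "homeomorphism N N' \<psi> \<phi>"
    using homeomorphism_compact[OF RA.R.compact _ im inj] by blast
  moreover have "\<psi> (return_map h N x) = return_map h' N' (\<psi> x)" if x: "x \<in> N" for x
  proof -
    define y where "y = \<psi> x"
    have y: "y \<in> C'" "y \<in> N'" using inC[OF x] by (simp_all add: y_def)
    obtain a :: "real \<Rightarrow> real" where a: "strict_mono a" "surj a" "a (\<sigma> x) = 0" "\<And>s. G (A.cov (x, s)) = B.cov (y, a s)"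
      by (rule clock[OF inC(1)[OF x] y(1) G\<sigma>[OF inC(2)[OF x], folded y_def]]) (rule that; assumption)
    have fwd: "\<exists>n. \<psi> (A.H m x) = B.H n y \<and> a (\<sigma> (A.H m x) + m) = of_int n" if m: "A.H m x \<in> N" for m
    proof -
      let ?w = "A.H m x"
      have "B.cov (\<psi> ?w, 0) = G (A.cov (?w, \<sigma> ?w))" using G\<sigma>[OF inC(2)[OF m]] by (rule sym)
      also have "\<dots> = B.cov (y, a (\<sigma> ?w + m))" by (simp only: A.cov_shift[OF inC(1)[OF x]] a(4))
      finally have "B.cov (y, a (\<sigma> ?w + m)) = B.cov (\<psi> ?w, 0)" by (rule sym)
      then show ?thesis unfolding B.cov_eq_iff[OF y(1) inC(4)[OF m]] by simp
    qed
    have bwd: "\<exists>m. A.H m x \<in> N \<and> \<psi> (A.H m x) = B.H n y \<and> a (\<sigma> (A.H m x) + m) = of_int n"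
      if n: "B.H n y \<in> N'" for n
    proof -
      obtain w where w: "w \<in> N" "\<psi> w = B.H n y" using n unfolding im[symmetric] by (metis imageE)
      obtain u where u: "of_int n = a u" using a(2) by (metis surjD)
      have "G (A.cov (w, \<sigma> w)) = B.cov (B.H n y, 0)" using G\<sigma>[OF inC(2)[OF w(1)]] w(2) by simp
      also have "\<dots> = B.cov (y, a u)" using B.cov_shift[OF y(1), of n 0] u by simp
      also have "\<dots> = G (A.cov (x, u))" by (rule a(4)[symmetric])
      finally have "G (A.cov (x, u)) = G (A.cov (w, \<sigma> w))" by (rule sym)
      then obtain m where "w = A.H m x" "u = \<sigma> w + of_int m"
        using G_inj inC(1) x w(1) by blast
      then show ?thesis using w u by metis
    qed
    txt \<open>Visits of \<open>x\<close> to \<open>N\<close> at time \<open>m\<close> and of \<open>y\<close> to \<open>N'\<close> at time \<open>n\<close> thus correspond; the time change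
      \<open>a\<close> is increasing and \<open>\<sigma>\<close> varies by less than 1, so the correspondence preserves order.\<close>
    have order: "n1 < n2" if "A.H m1 x \<in> N" "A.H m2 x \<in> N" "m1 < m2"
      "a (\<sigma> (A.H m1 x) + m1) = of_int n1" "a (\<sigma> (A.H m2 x) + m2) = of_int n2" for m1 m2 n1 n2
    proof -
      have "real_of_int m1 + 1 \<le> m2" using that(3) by linarith
      then have "\<sigma> (A.H m1 x) + m1 < \<sigma> (A.H m2 x) + m2"
        using near[OF inC(2)[OF that(1)] inC(2)[OF that(2)]] by linarith
      then have "real_of_int n1 < of_int n2" unfolding that(4,5)[symmetric] using a(1) by (simp add: strict_mono_less)
      then show ?thesis by simp
    qed
    have zero: "a (\<sigma> (A.H 0 x) + of_int 0) = of_int 0" "A.H 0 x \<in> N" using a(3) x by simp_all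
    \<comment> \<open>The first return of \<open>x\<close>, at time \<open>m\<close>, corresponds to
      a visit of \<open>y\<close> at time \<open>n\<close>; it remains to see that \<open>n\<close>
      is the first return time \<open>n'\<close> of \<open>y\<close>.\<close>
    define m where "m = int (RA.\<rho> x)"
    have m: "m \<ge> 1" "A.H m x \<in> N" using RA.\<rho>_pos RA.return_in inC(1)[OF x] by (simp_all add: m_def)
    obtain n where n: "\<psi> (A.H m x) = B.H n y" "a (\<sigma> (A.H m x) + m) = of_int n" using fwd[OF m(2)] by blast
    have "n > 0" using order[OF zero(2) m(2) _ zero(1) n(2)] m(1) by simp
    have nN: "B.H n y \<in> N'" using inC(3)[OF m(2)] n(1) by simp
    define n' where "n' = int (RB.\<rho> y)"
    have n': "n' \<ge> 1" "B.H n' y \<in> N'" using RB.\<rho>_pos RB.return_in y(1) by (simp_all add: n'_def)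
    have "n' \<le> n" using RB.no_earlier_return[OF \<open>n > 0\<close>, of y] nN unfolding n'_def by linarith
    moreover have "n \<le> n'"
    proof -
      obtain m' where m': "A.H m' x \<in> N" "a (\<sigma> (A.H m' x) + m') = of_int n'" using bwd[OF n'(2)] by blast
      \<comment> \<open>The visit of \<open>x\<close> matching \<open>n'\<close> comes after the
        visit at time 0, which matches 0, and hence no earlier than \<open>m\<close>; so
        \<open>n \<le> n'\<close>.\<close>
      have "m' \<noteq> 0" using m'(2) zero(1) n'(1) by auto
      moreover have "\<not> m' < 0" using order[OF m'(1) zero(2) _ m'(2) zero(1)] n'(1) by linarith
      ultimately have "m \<le> m'" using RA.no_earlier_return[of m' x] m'(1) unfolding m_def by linarith
      then show ?thesis
      proof (cases "m = m'")
        case True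
        then show ?thesis using n(2) m'(2) by simp
      next
        case False
        then show ?thesis using order[OF m(2) m'(1) _ n(2) m'(2)] \<open>m \<le> m'\<close> by simp
      qed
    qed
    ultimately have "n = n'" by simp
    then show ?thesis using n(1) unfolding RA.r_eq RB.r_eq m_def n'_def y_def by simp
  qed
  ultimately have "top_conjugate N (return_map h N) N' (return_map h' N')" unfolding top_conjugate_def by blast
  then show ?thesis using clN by (intro exI[of _ N]) (auto simp: N_def)
qed

text \<open>Around each point of \<open>C'\<close> a cross-section handles all small clopen sets at
  once, and a Lebesgue number of the resulting open cover serves as \<open>\<delta>\<close>.\<close>

lemma germ_dir: "germ_dir C h C' h'"
  unfolding germ_dir_def
proof (intro allI impI)
  fix K assume K: "clopen_in C K"
  \<comment> \<open>Quantifying over all clopen subsets makes \<open>good\<close> pass to smaller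
    sets, so it suffices to place \<open>N'\<close> inside one member of the cover.\<close>
  define good where "good V \<longleftrightarrow> (\<forall>N'. clopen_in C' N' \<and> N' \<subseteq> V \<longrightarrow>
      (\<exists>N. clopen_in C N \<and> N \<subseteq> K \<and> top_conjugate N (return_map h N) N' (return_map h' N')))" for V
  define \<G> where "\<G> = {W. open W \<and> good (C' \<inter> W)}"
  have "C' \<subseteq> \<Union>\<G>"
  proof
    fix y assume y: "y \<in> C'"
    obtain U \<psi> and \<sigma> :: "'a \<Rightarrow> real" where T: "clopen_in C U" "U \<subseteq> K" "continuous_on U \<psi>" "y \<in> \<psi> ` U"
      "clopen_in C' (\<psi> ` U)" "\<And>x. x \<in> U \<Longrightarrow> G (A.cov (x, \<sigma> x)) = B.cov (\<psi> x, 0)"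
      "\<And>x w. x \<in> U \<Longrightarrow> w \<in> U \<Longrightarrow> \<bar>\<sigma> x - \<sigma> w\<bar> < 1"
      using transversal[OF K y] by blast
    have "good (\<psi> ` U)" unfolding good_def
    proof (intro allI impI)
      fix N' assume "clopen_in C' N' \<and> N' \<subseteq> \<psi> ` U"
      then obtain N where "clopen_in C N" "N \<subseteq> U" "top_conjugate N (return_map h N) N' (return_map h' N')"
        using conjugate_return_maps[OF T(1,3,5,6,7)] by blast
      then show "\<exists>N. clopen_in C N \<and> N \<subseteq> K \<and> top_conjugate N (return_map h N) N' (return_map h' N')"
        using T(2) by blast
    qed
    moreover obtain W where "open W" "\<psi> ` U = C' \<inter> W"
      using T(5) unfolding clopen_in_def openin_open by blast
    ultimately have "W \<in> \<G>" "y \<in> W" using T(4) unfolding \<G>_def by auto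
    then show "y \<in> \<Union>\<G>" by blast
  qed
  \<comment> \<open>\<open>\<epsilon>\<close> is a Lebesgue number; a set of diameter below
    \<open>\<epsilon>\<close> lies in the \<open>\<epsilon>\<close>-ball around any of its
    points.\<close>
  then obtain \<epsilon> where \<epsilon>: "\<epsilon> > 0" "\<And>x. x \<in> C' \<Longrightarrow> \<exists>W\<in>\<G>. ball x \<epsilon> \<subseteq> W"
    using Heine_Borel_lemma[OF B.compact] unfolding \<G>_def by blast
  show "\<exists>\<delta>>0. \<forall>N'. clopen_in C' N' \<and> diameter N' < \<delta> \<longrightarrow>
           (\<exists>N. clopen_in C N \<and> N \<subseteq> K \<and> top_conjugate N (return_map h N) N' (return_map h' N'))"
  proof (intro exI[of _ \<epsilon>] conjI allI impI)
    fix N' assume N': "clopen_in C' N' \<and> diameter N' < \<epsilon>"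
    then obtain x where x: "x \<in> N'" "x \<in> C'" "N' \<subseteq> C'" unfolding clopen_in_def by blast
    then have "bounded N'" using B.compact compact_imp_bounded bounded_subset by blast
    then have "N' \<subseteq> ball x \<epsilon>" using diameter_bounded_bound[of N' x] x(1) N' by fastforce
    moreover obtain W where W: "W \<in> \<G>" "ball x \<epsilon> \<subseteq> W" using \<epsilon>(2)[OF x(2)] by blast
    ultimately have "N' \<subseteq> C' \<inter> W" using x(3) by blast
    then show "\<exists>N. clopen_in C N \<and> N \<subseteq> K \<and> top_conjugate N (return_map h N) N' (return_map h' N')"
      using W(1) N' unfolding \<G>_def good_def by blast
  qed (fact \<epsilon>(1))
qed

end

section \<open>The two implications\<close>

lemma flow_equivalent_imp_germ_dir:
  fixes C' :: "'b::metric_space set" and C :: "'a::metric_space set"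
  assumes "cantor_minimal C h" and "cantor_minimal C' h'" and fe: "flow_equivalent C h C' h'"
  shows "germ_dir C h C' h'"
proof -
  interpret A: cantor_minimal C h by fact
  interpret B: cantor_minimal C' h' by fact
  obtain G where "flow_equivalence_axioms C h C' h' G"
    using fe unfolding flow_equivalent_def flow_equivalence_axioms_def by blast
  then interpret flow_equivalence C h C' h' G by (intro flow_equivalence.intro assms(1,2))
  show ?thesis by (rule germ_dir)
qed

text \<open>With \<open>K = C\<close>, a single small clopen \<open>N'\<close> yields conjugate
  return maps on \<open>N\<close> and \<open>N'\<close>. The chain from \<open>C\<close> through
  \<open>N\<close> and \<open>N'\<close> to \<open>C'\<close> then consists of flow
  equivalences.\<close>

lemma germ_dir_imp_flow_equivalent:
  fixes C' :: "'b::metric_space set" and C :: "'a::metric_space set"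
  assumes "cantor_minimal C h" and "cantor_minimal C' h'" and g: "germ_dir C h C' h'"
  shows "flow_equivalent C h C' h'"
proof -
  interpret A: cantor_minimal C h by fact
  interpret B: cantor_minimal C' h' by fact
  have "C \<noteq> {}" "C' \<noteq> {}" using A.cantor B.cantor by (auto simp: cantor_set_def)
  then have "clopen_in C C" by (auto simp: clopen_in_def)
  then obtain \<delta> where d: "\<delta> > 0" "\<And>N'. clopen_in C' N' \<Longrightarrow> diameter N' < \<delta> \<Longrightarrow>
      \<exists>N. clopen_in C N \<and> top_conjugate N (return_map h N) N' (return_map h' N')"
    using g unfolding germ_dir_def by blast
  obtain y where y: "y \<in> C'" using \<open>C' \<noteq> {}\<close> by blast
  \<comment> \<open>Radius \<open>\<delta>/3\<close> bounds the diameter by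
    \<open>2 * (\<delta>/3)\<close>, strictly below \<open>\<delta>\<close>.\<close>
  have "openin (top_of_set C') (C' \<inter> ball y (\<delta>/3))" by (simp add: openin_open_Int)
  moreover have "y \<in> C' \<inter> ball y (\<delta>/3)" using y d(1) by simp
  ultimately obtain N' where N': "clopen_in C' N'" "N' \<subseteq> C' \<inter> ball y (\<delta>/3)" using B.clopen_basis by metis
  have "diameter N' \<le> 2 * (\<delta>/3)"
  proof -
    have "dist u v \<le> 2 * (\<delta>/3)" if "u \<in> N'" "v \<in> N'" for u v
    proof -
      have "dist y u < \<delta>/3" "dist y v < \<delta>/3" using N'(2) that by auto
      then show ?thesis using dist_triangle3[of u v y] by linarith
    qed
    then have "(SUP (u, v)\<in>N' \<times> N'. dist u v) \<le> 2 * (\<delta>/3)"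
      using N'(1) unfolding clopen_in_def by (intro cSUP_least) auto
    then show ?thesis using N'(1) unfolding diameter_def clopen_in_def by (simp only: if_False)
  qed
  then obtain N where N: "clopen_in C N" "top_conjugate N (return_map h N) N' (return_map h' N')"
    using d(2)[OF N'(1)] d(1) by fastforce
  interpret RA: return_system C h N by unfold_locales (rule N(1))
  interpret RB: return_system C' h' N' by unfold_locales (rule N'(1))
  have "flow_equivalent C h N (return_map h N)"
    by (rule flow_equivalent_sym[OF RA.R.compact_homeo_axioms assms(1) RA.flow_equivalent_return])
  moreover have "flow_equivalent N (return_map h N) N' (return_map h' N')"
    by (rule flow_equivalent_conjugate[OF RA.R.compact_homeo_axioms RB.R.compact_homeo_axioms N(2)])
  ultimately show ?thesis
    using RB.flow_equivalent_return by (blast intro: flow_equivalent_trans)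
qed

theorem theorem5p5:
  fixes C1 :: "'a::metric_space set" and h1 :: "'a \<Rightarrow> 'a"
    and C2 :: "'b::metric_space set" and h2 :: "'b \<Rightarrow> 'b"
  assumes "cantor_set C1" and "cantor_set C2"
    and "minimal_homeo C1 h1" and "minimal_homeo C2 h2"
  shows "germinally_equivalent C1 h1 C2 h2 \<longleftrightarrow> flow_equivalent C1 h1 C2 h2"
proof -
  interpret A: cantor_minimal C1 h1 using assms by unfold_locales
  interpret B: cantor_minimal C2 h2 using assms by unfold_locales
  note cm = A.cantor_minimal_axioms B.cantor_minimal_axioms
  show ?thesis
  proof
    assume "germinally_equivalent C1 h1 C2 h2"
    then show "flow_equivalent C1 h1 C2 h2"
      using germ_dir_imp_flow_equivalent[OF cm] by (simp add: germinally_equivalent_def)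
  next
    assume fe: "flow_equivalent C1 h1 C2 h2"
    then have "flow_equivalent C2 h2 C1 h1"
      by (rule flow_equivalent_sym[OF A.compact_homeo_axioms cm(2)])
    then show "germinally_equivalent C1 h1 C2 h2"
      using flow_equivalent_imp_germ_dir[OF cm fe] flow_equivalent_imp_germ_dir[OF cm(2,1)]
      by (simp add: germinally_equivalent_def)
  qed
qed

end
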